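(* Let $\alpha\in(1,2]$, $\sigma>0$, $u>0$, $S>0$, $K_1>0$, $K_2>0$, $r\in\mathbb{R}$, $\tau>0$, let $X_t\sim L(0,\sigma^\alpha,-1)$, and put $\mu=\sigma^\alpha/\cos\frac{\pi\alpha}{2}$ and $k_u:=\log\frac{S}{K_2^{1/u}}+r\tau$. The value of the gap power call option with strike $K_1$ and trigger $K_2$, i.e. the option with payoff $\mathcal{P}^{(Gap)}(S_T,K_1,K_2)=(S_T^u-K_1)\mathbf{1}_{\{S_T^u-K_2>0\}}$, is $$C_\alpha^{(Gap)}(S,K_1,K_2,r,\mu,\tau)=C_\alpha^{(A/N)}(S,K_2,r,\mu,\tau)-K_1\,C_\alpha^{(C/N)}(S,K_2,r,\mu,\tau),$$ where $$C_\alpha^{(A/N)}(S,K_2,r,\mu,\tau)=\frac{K_2 e^{-r\tau}}{\alpha}\sum_{n=0}^\infty\sum_{m=0}^\infty\frac{u^m\,(k_u+\mu\tau)^n\,(-\mu\tau)^{\frac{m-n}{\alpha}}}{n!\,\Gamma\left(1+\frac{m-n}{\alpha}\right)},$$ $$C_\alpha^{(C/N)}(S,K_2,r,\mu,\tau)=\frac{e^{-r\tau}}{\alpha}\sum_{n=0}^\infty\frac{(k_u+\mu\tau)^n\,(-\mu\tau)^{-\frac{n}{\alpha}}}{n!\,\Gamma\left(1-\frac{n}{\alpha}\right)}.$$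
   Context: The process $X_t\sim L(0,\sigma^\alpha,-1)$ is the spectrally negative $\alpha$-stable Lévy process with characteristic function $\mathbb{E}[e^{ikX_t}]=\exp\left(-t\,\sigma^\alpha|k|^\alpha\left(1+i\tan\frac{\alpha\pi}{2}\,\mathrm{sgn}\,k\right)\right)$ for $k\in\mathbb{R}$; equivalently $\mathbb{E}[e^{pX_t}]=e^{-\mu t p^\alpha}$ for $p>0$, with $\mu=\sigma^\alpha/\cos\frac{\pi\alpha}{2}<0$. The asset price at maturity is $S_T=S\,e^{(r+\mu)\tau+X_\tau}$, where $\tau$ is the time-to-maturity, and the value of an option with payoff $\mathcal{P}(S_T,\cdot)$ is $e^{-r\tau}\,\mathbb{E}\left[\mathcal{P}\left(Se^{(r+\mu)\tau+X_\tau},\cdot\right)\right]$. Conventions: $1/\Gamma(z)=0$ when $z$ is a non-positive integer, and $0^0=1$. *)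

theory Defs
  imports "HOL-Probability.Probability"
begin

text \<open>
  A real Levy process indexed by \<open>t \<ge> 0\<close> (the values of \<open>X t\<close> for \<open>t < 0\<close> are irrelevant).
  Path regularity is required only in the form of stochastic continuity; cadlag paths are not needed.
\<close>

locale levy_process = prob_space M for M :: "'a measure" +
  fixes X :: "real \<Rightarrow> 'a \<Rightarrow> real"
  assumes rv: "\<And>t. 0 \<le> t \<Longrightarrow> random_variable borel (X t)"
    and start_zero: "AE \<omega> in M. X 0 \<omega> = 0"
    and independent_increments:
      "\<And>(n::nat) (t :: nat \<Rightarrow> real). 0 \<le> t 0 \<Longrightarrow> (\<And>i. i < n \<Longrightarrow> t i \<le> t (Suc i)) \<Longrightarrow>
         indep_vars (\<lambda>_. borel) (\<lambda>i \<omega>. X (t (Suc i)) \<omega> - X (t i) \<omega>) {..<n}"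
    and stationary_increments:
      "\<And>s t. 0 \<le> s \<Longrightarrow> 0 \<le> t \<Longrightarrow>
         distr M borel (\<lambda>\<omega>. X (s + t) \<omega> - X s \<omega>) = distr M borel (X t)"
    and stochastically_continuous:
      "\<And>t \<epsilon>. 0 \<le> t \<Longrightarrow> 0 < \<epsilon> \<Longrightarrow>
         ((\<lambda>s. prob {\<omega> \<in> space M. \<bar>X s \<omega> - X t \<omega>\<bar> > \<epsilon>}) \<longlongrightarrow> 0) (at t within {0..})"

text \<open>The spectrally negative stable process \<open>X\<^sub>t \<sim> L(0, \<sigma>\<^sup>\<alpha>, -1)\<close>.\<close>

locale spectrally_negative_stable_process = levy_process M X
  for M :: "'a measure" and X :: "real \<Rightarrow> 'a \<Rightarrow> real" +
  fixes \<alpha> \<sigma> :: real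
  assumes char_stable:
    "\<And>t k. 0 \<le> t \<Longrightarrow>
       char (distr M borel (X t)) k =
         exp (- (of_real (t * \<sigma> powr \<alpha> * \<bar>k\<bar> powr \<alpha>) *
                 (1 + \<i> * of_real (tan (\<alpha> * pi / 2) * sgn k))))"

definition stable_mu :: "real \<Rightarrow> real \<Rightarrow> real" where
  "stable_mu \<alpha> \<sigma> = \<sigma> powr \<alpha> / cos (pi * \<alpha> / 2)"

definition terminal_price :: "real \<Rightarrow> real \<Rightarrow> real \<Rightarrow> real \<Rightarrow> real \<Rightarrow> real" where
  "terminal_price S r \<mu> \<tau> x = S * exp ((r + \<mu>) * \<tau> + x)"

definition option_value ::
  "'a measure \<Rightarrow> (real \<Rightarrow> 'a \<Rightarrow> real) \<Rightarrow> (real \<Rightarrow> real) \<Rightarrow> real \<Rightarrow> real \<Rightarrow> real \<Rightarrow> real \<Rightarrow> real" where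
  "option_value M X payoff S r \<mu> \<tau> =
     exp (- r * \<tau>) * (\<integral>\<omega>. payoff (terminal_price S r \<mu> \<tau> (X \<tau> \<omega>)) \<partial>M)"

definition gap_power_call_payoff :: "real \<Rightarrow> real \<Rightarrow> real \<Rightarrow> real \<Rightarrow> real" where
  "gap_power_call_payoff u K1 K2 s = (s powr u - K1) * indicator {x. x powr u - K2 > 0} s"

definition log_moneyness :: "real \<Rightarrow> real \<Rightarrow> real \<Rightarrow> real \<Rightarrow> real \<Rightarrow> real" where
  "log_moneyness u S K r \<tau> = ln (S / K powr (1 / u)) + r * \<tau>"

text \<open>
  \<open>rGamma\<close> is the entire function \<open>1/\<Gamma>\<close>, which vanishes at the non-positive integers.
  The base \<open>- \<mu> * \<tau>\<close> of the real powers below is positive whenever \<open>\<mu> < 0 < \<tau>\<close>.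
\<close>

definition AN_term ::
  "real \<Rightarrow> real \<Rightarrow> real \<Rightarrow> real \<Rightarrow> real \<Rightarrow> real \<Rightarrow> real \<Rightarrow> nat \<Rightarrow> nat \<Rightarrow> real" where
  "AN_term \<alpha> u S K r \<mu> \<tau> n m =
     u ^ m * (log_moneyness u S K r \<tau> + \<mu> * \<tau>) ^ n
       * (- \<mu> * \<tau>) powr ((real m - real n) / \<alpha>) / fact n
       * rGamma (1 + (real m - real n) / \<alpha>)"

definition CN_term ::
  "real \<Rightarrow> real \<Rightarrow> real \<Rightarrow> real \<Rightarrow> real \<Rightarrow> real \<Rightarrow> real \<Rightarrow> nat \<Rightarrow> real" where
  "CN_term \<alpha> u S K r \<mu> \<tau> n =
     (log_moneyness u S K r \<tau> + \<mu> * \<tau>) ^ n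
       * (- \<mu> * \<tau>) powr (- real n / \<alpha>) / fact n
       * rGamma (1 - real n / \<alpha>)"

definition C_AN :: "real \<Rightarrow> real \<Rightarrow> real \<Rightarrow> real \<Rightarrow> real \<Rightarrow> real \<Rightarrow> real \<Rightarrow> real" where
  "C_AN \<alpha> u S K r \<mu> \<tau> =
     K * exp (- r * \<tau>) / \<alpha> * (\<Sum>n. \<Sum>m. AN_term \<alpha> u S K r \<mu> \<tau> n m)"

definition C_CN :: "real \<Rightarrow> real \<Rightarrow> real \<Rightarrow> real \<Rightarrow> real \<Rightarrow> real \<Rightarrow> real \<Rightarrow> real" where
  "C_CN \<alpha> u S K r \<mu> \<tau> =
     exp (- r * \<tau>) / \<alpha> * (\<Sum>n. CN_term \<alpha> u S K r \<mu> \<tau> n)"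

end

theory Submission
  imports Defs
begin

text \<open>
  Put \<open>c = - \<mu> \<tau> > 0\<close> and \<open>y = k\<^sub>u + \<mu> \<tau>\<close>. The characteristic function of \<open>X\<^sub>\<tau>\<close> at \<open>k\<close> is
  \<open>exp (c q\<^sup>\<alpha>)\<close> at \<open>q = i k\<close>. It is integrable, so \<open>X\<^sub>\<tau>\<close> has the density
  \<open>1/(2\<pi>) \<integral> exp (- q x + c q\<^sup>\<alpha>) dk\<close>, and by analyticity the line of integration may be moved from
  \<open>q = i k\<close> to \<open>q = p + i k\<close> with any \<open>p > 0\<close>. For \<open>p > u\<close>, integrating against the payoff gives
  \<open>E[exp (u (y + X)); X > - y] = 1/(2\<pi>) \<integral> exp (q y + c q\<^sup>\<alpha>) / (q - u) dk\<close>. Since \<open>\<alpha> > 1\<close>, the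
  exponential \<open>exp (q y)\<close> and then the geometric series of \<open>1/(q - u)\<close> can be expanded under the
  integral, and the resulting integrals of \<open>q\<^sup>s exp (c q\<^sup>\<alpha>)\<close> are Hankel integrals for \<open>1/\<Gamma>\<close>.
  The same formula with \<open>u = 0\<close> gives the cash-or-nothing part.
\<close>

section \<open>Decay on vertical lines\<close>

text \<open>Two obstructions pull in opposite directions. The payoff integral over
  \<open>x > - y\<close> converges only for Re q > u, and the series of 1/(q - u) in powers of u/q
  needs |q| to stay above u, so the expansions live on a line Re q = p > u and produce powers q^(n -
  m - 1) of either sign. The integrals of q^s exp (c q^\<alpha>), however, reduce to Gamma integrals
  on the imaginary axis, where negative powers are singular at the branch point 0. Hence the shift
  to the axis is made only for large s. The shift itself uses no contours: the p-derivative of the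
  integral of F (p + i k) over k is the integral of F' (p + i k), which is a total derivative along
  the line and vanishes. The branch point costs only the null set k = 0. Every interchange rests on
  one estimate: cos (pi \<alpha> / 2) < 0 makes exp (c q^\<alpha>) decay on vertical strips faster
  than any exp (- B |k|). The expansions are made one at a time, the series in n with 1/(q - u) kept
  whole and the series in m for fixed n, which matches the iterated sum claimed.\<close>

lemma powr_le_one_plus:
  fixes x t :: real
  assumes "0 \<le> x" "0 \<le> t" "t \<le> 1"
  shows "x powr t \<le> 1 + x"
proof (cases "x \<le> 1")
  case True
  then have "x powr t \<le> 1" using assms by (simp add: powr_le1)
  then show ?thesis using assms by linarith
next
  case False
  then have "x powr t \<le> x powr 1" using assms by (intro powr_mono) auto
  then show ?thesis using False by simp
qed

lemma linear_minus_powr_bounded: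
  fixes a \<alpha> B :: real
  assumes "0 < a" "1 < \<alpha>"
  shows "\<exists>C. \<forall>x\<ge>0. B * x - a * x powr \<alpha> \<le> C"
proof -
  \<comment> \<open>\<open>R\<close> is where the two terms balance,
    \<open>\<bar>B\<bar> = a * R powr (\<alpha> - 1)\<close>: beyond it the power wins, below it the
    linear term is at most \<open>\<bar>B\<bar> * R\<close>.\<close>
  define R where "R = (\<bar>B\<bar> / a) powr (1 / (\<alpha> - 1))"
  have "B * x - a * x powr \<alpha> \<le> \<bar>B\<bar> * R" if x: "0 \<le> x" for x
  proof (cases "x \<le> R")
    case True
    have "B * x \<le> \<bar>B\<bar> * x" using x by (simp add: mult_right_mono)
    also have "\<dots> \<le> \<bar>B\<bar> * R" using True by (intro mult_left_mono) auto
    finally show ?thesis using assms by (smt (verit) mult_nonneg_nonneg powr_ge_zero)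
  next
    case False
    have R0: "0 \<le> R" by (simp add: R_def)
    have "\<bar>B\<bar> / a = R powr (\<alpha> - 1)" using assms by (simp add: R_def powr_powr)
    also have "\<dots> \<le> x powr (\<alpha> - 1)" using False R0 assms by (intro powr_mono2) auto
    finally have "\<bar>B\<bar> \<le> a * x powr (\<alpha> - 1)" using assms by (simp add: field_simps)
    then have "\<bar>B\<bar> * x \<le> a * x powr (\<alpha> - 1) * x" using x by (intro mult_right_mono) auto
    also have "\<dots> = a * x powr \<alpha>" using False R0 by (simp add: powr_diff)
    finally have "B * x \<le> a * x powr \<alpha>" using x by (smt (verit) mult_right_mono)
    moreover have "0 \<le> \<bar>B\<bar> * R" using R0 by simp
    ultimately show ?thesis by linarith
  qed
  then show ?thesis by blast
qed

lemma imaginary_powr: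
  fixes k s :: real
  assumes "0 < k"
  shows "Complex 0 k powr of_real s = of_real (k powr s) * cis (pi * s / 2)"
proof -
  have e: "Complex 0 k = \<i> * of_real k" by (simp add: complex_eq_iff)
  have "Ln (Complex 0 k) = of_real (ln k) + \<i> * of_real pi / 2"
    unfolding e using assms Ln_times_of_real[of k \<i>] by (simp add: mult.commute Ln_of_real)
  then have "Complex 0 k powr of_real s = exp (of_real s * (of_real (ln k) + \<i> * of_real pi / 2))"
    using assms by (auto simp: powr_def complex_eq_iff[of _ 0])
  also have "\<dots> = exp (of_real (s * ln k)) * exp (\<i> * of_real (pi * s / 2))"
    by (simp add: exp_add[symmetric] algebra_simps)
  finally show ?thesis using assms by (simp add: cis_conv_exp powr_def exp_of_real[symmetric])
qed

lemma imaginary_powr_neg: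
  fixes k s :: real
  assumes "0 < k"
  shows "Complex 0 (- k) powr of_real s = of_real (k powr s) * cis (- (pi * s / 2))"
proof -
  have "Complex 0 (- k) powr of_real s = cnj (Complex 0 k) powr cnj (of_real s)"
    by (simp add: complex_of_real_def cnj.code)
  also have "\<dots> = cnj (Complex 0 k powr of_real s)"
    using assms by (subst cnj_powr) (auto simp: complex_nonpos_Reals_iff)
  finally show ?thesis using imaginary_powr[OF assms] by (simp add: cis_cnj)
qed

lemma Re_imaginary_powr:
  "Re (Complex 0 k powr of_real \<alpha>) = \<bar>k\<bar> powr \<alpha> * cos (pi * \<alpha> / 2)"
proof -
  consider "0 < k" | "k = 0" | "0 < - k" by linarith
  then show ?thesis
  proof cases
    case 1 then show ?thesis by (simp add: imaginary_powr)
  next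
    case 2 then show ?thesis by (simp add: zero_complex.code[symmetric])
  next
    case 3 then show ?thesis using imaginary_powr_neg[OF 3, of \<alpha>] by simp
  qed
qed

text \<open>This sign gives exp (c q^\<alpha>) with c > 0 its decay along the imaginary axis, and it
  makes \<open>stable_mu\<close> negative.\<close>

lemma cos_half_pi_neg:
  assumes "1 < \<alpha>" "\<alpha> \<le> 2"
  shows "cos (pi * \<alpha> / 2) < 0"
proof -
  have "cos (pi * \<alpha> / 2) = - sin (pi * (\<alpha> - 1) / 2)"
  proof -
    have e: "pi * \<alpha> / 2 = pi * (\<alpha> - 1) / 2 + pi / 2" by (simp add: field_simps)
    show ?thesis unfolding e by (simp add: cos_add)
  qed
  moreover have "0 < sin (pi * (\<alpha> - 1) / 2)"
  proof (rule sin_gt_zero)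
    show "0 < pi * (\<alpha> - 1) / 2" using assms by simp
    have "pi * (\<alpha> - 1) \<le> pi * 1" using assms by (intro mult_left_mono) auto
    then show "pi * (\<alpha> - 1) / 2 < pi" using pi_gt_zero by linarith
  qed
  ultimately show ?thesis by simp
qed

text \<open>Mean value inequality on the horizontal segment from \<open>Complex 0 k\<close> to
  \<open>Complex p k\<close>. The derivative \<alpha> z^(\<alpha> - 1) grows at most linearly since
  \<alpha> \<le> 2, so for bounded p leaving the axis costs O(1 + |k|), which the negative term in
  |k|^\<alpha> can absorb.\<close>

lemma Re_powr_le_half_plane:
  assumes \<alpha>: "1 < \<alpha>" "\<alpha> \<le> 2" and p: "0 \<le> p"
  shows "Re (Complex p k powr of_real \<alpha>) \<le> cos (pi * \<alpha> / 2) * \<bar>k\<bar> powr \<alpha> + 2 * p * (1 + p + \<bar>k\<bar>)"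
\<comment> \<open>For \<open>k = 0\<close> the segment would start at 0, on the cut of the principal
  power, so this case is estimated directly.\<close>
proof (cases "k = 0")
  case True
  have "Complex p 0 powr of_real \<alpha> = of_real (p powr \<alpha>)"
    using p by (simp add: complex_of_real_def[symmetric] powr_of_real)
  moreover have "p powr \<alpha> \<le> 2 * p * (1 + p)"
  proof (cases "p = 0")
    case False
    have "p powr \<alpha> = p * p powr (\<alpha> - 1)" using False p by (simp add: powr_diff)
    also have "\<dots> \<le> p * (1 + p)" using powr_le_one_plus[of p "\<alpha> - 1"] \<alpha> p by (intro mult_left_mono) auto
    also have "\<dots> \<le> 2 * p * (1 + p)" using p by simp
    finally show ?thesis .
  qed auto
  ultimately show ?thesis using True by (simp add: complex_of_real_def)
next
  case False
  let ?S = "closed_segment (Complex 0 k) (Complex p k)"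
  have S: "Im z = k \<and> 0 \<le> Re z \<and> Re z \<le> p" if z: "z \<in> ?S" for z
  proof -
    obtain u where u: "0 \<le> u" "u \<le> 1" "z = (1 - u) *\<^sub>R Complex 0 k + u *\<^sub>R Complex p k"
      using z by (auto simp: in_segment)
    have "u * p \<le> 1 * p" using u p by (intro mult_right_mono) auto
    moreover have "z = Complex (u * p) k" using u by (simp add: complex_eq_iff algebra_simps)
    ultimately show ?thesis using u p by simp
  qed
  have "norm (Complex p k powr of_real \<alpha> - Complex 0 k powr of_real \<alpha>)
      \<le> (2 * (1 + p + \<bar>k\<bar>)) * norm (Complex p k - Complex 0 k)"
  proof (rule field_differentiable_bound[where S = ?S])
    fix z assume z: "z \<in> ?S"
    note Sz = S[OF z]
    have "z \<notin> \<real>\<^sub>\<le>\<^sub>0" using Sz False by (auto simp: complex_nonpos_Reals_iff)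
    then show "((\<lambda>z. z powr of_real \<alpha>) has_field_derivative of_real \<alpha> * z powr (of_real \<alpha> - 1)) (at z within ?S)"
      by (rule has_field_derivative_at_within[OF has_field_derivative_powr])
    have "norm (z powr of_real (\<alpha> - 1)) = norm z powr (\<alpha> - 1)"
      by (subst norm_powr_real_powr') auto
    also have "\<dots> \<le> 1 + norm z" using \<alpha> by (intro powr_le_one_plus) auto
    also have "norm z \<le> p + \<bar>k\<bar>" using cmod_le[of z] Sz by simp
    finally have 1: "norm (z powr of_real (\<alpha> - 1)) \<le> 1 + p + \<bar>k\<bar>" by simp
    have "\<alpha> * norm (z powr of_real (\<alpha> - 1)) \<le> 2 * (1 + p + \<bar>k\<bar>)"
      using 1 \<alpha> by (intro mult_mono) auto
    then show "norm (of_real \<alpha> * z powr (of_real \<alpha> - 1)) \<le> 2 * (1 + p + \<bar>k\<bar>)"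
      using \<alpha> by (simp add: norm_mult)
  qed auto
  also have "norm (Complex p k - Complex 0 k) = p" using p by (simp add: cmod_def)
  finally have "Re (Complex p k powr of_real \<alpha>) - Re (Complex 0 k powr of_real \<alpha>) \<le> 2 * (1 + p + \<bar>k\<bar>) * p"
    by (metis complex_Re_le_cmod minus_complex.simps(1) order_trans)
  then show ?thesis by (simp add: Re_imaginary_powr algebra_simps)
qed

text \<open>The decay of order exp (- a |k|^\<alpha>) beats every exponential;
  \<open>exp (- \<bar>k\<bar>)\<close> is kept as a majorant that is easy to integrate. Uniformity
  over the strip \<open>0 \<le> p \<le> P\<close> is what line shifts require.\<close>

lemma exp_powr_bound:
  assumes \<alpha>: "1 < \<alpha>" "\<alpha> \<le> 2" and c: "0 < c" and B: "0 \<le> B"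
  shows "\<exists>C>0. \<forall>p k. 0 \<le> p \<longrightarrow> p \<le> P \<longrightarrow>
     exp (B * norm (Complex p k)) * norm (exp (of_real c * Complex p k powr of_real \<alpha>)) \<le> C * exp (- \<bar>k\<bar>)"
proof -
  define a where "a = - c * cos (pi * \<alpha> / 2)"
  have a: "0 < a" using cos_half_pi_neg[OF \<alpha>] c by (simp add: a_def mult_pos_neg)
  \<comment> \<open>All coefficients of |k| are collected: B from exp (B |q|), 2 c P from leaving
    the imaginary axis, and 1 so that \<open>exp (- \<bar>k\<bar>)\<close> is left over.\<close>
  define D where "D = B + 2 * c * P + 1"
  obtain C where C: "\<And>x. 0 \<le> x \<Longrightarrow> D * x - a * x powr \<alpha> \<le> C"
    using linear_minus_powr_bounded[OF a \<alpha>(1), of D] by blast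
  have "exp (B * norm (Complex p k)) * norm (exp (of_real c * Complex p k powr of_real \<alpha>))
      \<le> exp (B * P + 2 * c * P * (1 + P) + C) * exp (- \<bar>k\<bar>)" if p: "0 \<le> p" "p \<le> P" for p k
  proof -
    have 1: "B * norm (Complex p k) \<le> B * (P + \<bar>k\<bar>)"
      using cmod_le[of "Complex p k"] p B by (intro mult_left_mono) auto
    have "c * Re (Complex p k powr of_real \<alpha>) \<le> c * (cos (pi * \<alpha> / 2) * \<bar>k\<bar> powr \<alpha> + 2 * p * (1 + p + \<bar>k\<bar>))"
      using Re_powr_le_half_plane[OF \<alpha>, of p k] p c by (intro mult_left_mono) auto
    also have "\<dots> \<le> c * (cos (pi * \<alpha> / 2) * \<bar>k\<bar> powr \<alpha> + 2 * P * (1 + P + \<bar>k\<bar>))"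
      using p c by (intro mult_left_mono add_mono order_refl mult_mono) auto
    also have "\<dots> = - a * \<bar>k\<bar> powr \<alpha> + 2 * c * P * (1 + P) + 2 * c * P * \<bar>k\<bar>"
      by (simp add: a_def algebra_simps)
    finally have 2: "c * Re (Complex p k powr of_real \<alpha>) \<le> \<dots>" .
    have 3: "D * \<bar>k\<bar> - a * \<bar>k\<bar> powr \<alpha> \<le> C" by (rule C) auto
    have "B * norm (Complex p k) + c * Re (Complex p k powr of_real \<alpha>)
        \<le> B * P + 2 * c * P * (1 + P) + C - \<bar>k\<bar>"
      using 1 2 3 by (simp add: D_def algebra_simps)
    then show ?thesis by (simp add: exp_add[symmetric])
  qed
  then show ?thesis by (intro exI[of _ "exp (B * P + 2 * c * P * (1 + P) + C)"]) auto
qed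

lemma integrable_exp_neg_abs: "integrable lborel (\<lambda>k::real. exp (- \<bar>k\<bar>))"
proof -
  have 1: "integrable lborel (\<lambda>x::real. exp (-x) * indicator {0 ..} x)"
    using has_bochner_integral_I0i_power_exp_m'[of 0] by (auto simp: has_bochner_integral_iff)
  have 2: "integrable lborel (\<lambda>x::real. exp x * indicator {0 ..} (- x))"
    using lborel_integrable_real_affine[OF 1, of "-1" 0] by simp
  show ?thesis
    by (rule Bochner_Integration.integrable_bound[OF Bochner_Integration.integrable_add[OF 1 2]])
      (auto simp: indicator_def)
qed

section \<open>Shifting vertical lines\<close>

lemma Complex_has_vector_derivative_Im:
  "((\<lambda>k. Complex p k) has_vector_derivative \<i>) (at k)"
  unfolding Complex_eq by (auto intro!: derivative_eq_intros)

lemma Complex_has_vector_derivative_Re: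
  "((\<lambda>p. Complex p k) has_vector_derivative 1) (at p)"
  unfolding Complex_eq by (auto intro!: derivative_eq_intros)

lemma continuous_on_vertical:
  assumes "continuous_on {q. 0 < Re q} F" "0 < p"
  shows "continuous_on UNIV (\<lambda>k. F (Complex p k))"
  by (rule continuous_on_compose2[OF assms(1)]) (use assms(2) in \<open>auto intro!: continuous_intros\<close>)

lemma integrable_exp_abs_bound:
  fixes f :: "real \<Rightarrow> complex"
  assumes "f \<in> borel_measurable borel" "\<And>k. norm (f k) \<le> C * exp (- \<bar>k\<bar>)"
  shows "integrable lborel f"
  by (rule Bochner_Integration.integrable_bound[OF integrable_mult_right[OF integrable_exp_neg_abs, of C]])
     (use assms in \<open>auto intro: order_trans[OF _ abs_ge_self]\<close>)

lemma integrable_vertical: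
  fixes F :: "complex \<Rightarrow> complex"
  assumes "continuous_on {q. 0 < Re q} F" "0 < p"
    "\<And>k. norm (F (Complex p k)) \<le> C * exp (- \<bar>k\<bar>)"
  shows "integrable lborel (\<lambda>k. F (Complex p k))"
  by (rule integrable_exp_abs_bound[OF borel_measurable_continuous_onI[OF continuous_on_vertical]])
     (use assms in auto)

lemma exp_neg_abs_tendsto_0:
  "((\<lambda>k::real. C * exp (- \<bar>k\<bar>)) \<longlongrightarrow> 0) at_top" "((\<lambda>k::real. C * exp (- \<bar>k\<bar>)) \<longlongrightarrow> 0) at_bot"
proof -
  have "((\<lambda>k::real. C * exp (- k)) \<longlongrightarrow> C * 0) at_top"
    by (intro tendsto_intros filterlim_compose[OF exp_at_bot] filterlim_uminus_at_bot_at_top)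
  then show 1: "((\<lambda>k::real. C * exp (- \<bar>k\<bar>)) \<longlongrightarrow> 0) at_top"
    by (rule Lim_transform_eventually[OF tendsto_eq_rhs])
       (auto intro: eventually_mono[OF eventually_ge_at_top[of 0]])
  show "((\<lambda>k::real. C * exp (- \<bar>k\<bar>)) \<longlongrightarrow> 0) at_bot"
    using 1 by (simp add: at_bot_mirror filterlim_filtermap)
qed

text \<open>Up to a factor i the integrand is the derivative of F along the line, and F vanishes at
  both ends. The lemma serves twice: to shift lines and to integrate by parts.\<close>

lemma integral_vertical_derivative_zero:
  fixes F F' :: "complex \<Rightarrow> complex"
  assumes p: "0 < p"
    and deriv: "\<And>q. 0 < Re q \<Longrightarrow> (F has_field_derivative F' q) (at q)"
    and cont: "continuous_on {q. 0 < Re q} F'"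
    and bF: "\<And>k. norm (F (Complex p k)) \<le> C * exp (- \<bar>k\<bar>)"
    and bF': "\<And>k. norm (F' (Complex p k)) \<le> D * exp (- \<bar>k\<bar>)"
  shows "(\<integral>k. F' (Complex p k) \<partial>lborel) = 0"
proof -
  have int: "integrable lborel (\<lambda>k. F' (Complex p k))"
    by (rule integrable_vertical[OF cont p bF'])
  have lim: "((\<lambda>k. F (Complex p k)) \<longlongrightarrow> 0) at_top" "((\<lambda>k. F (Complex p k)) \<longlongrightarrow> 0) at_bot"
    by (rule Lim_null_comparison[OF always_eventually[OF allI[OF bF]] exp_neg_abs_tendsto_0(1)])
       (rule Lim_null_comparison[OF always_eventually[OF allI[OF bF]] exp_neg_abs_tendsto_0(2)])
  have "(LBINT k=-\<infinity>..\<infinity>. \<i> * F' (Complex p k)) = 0 - 0"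
  proof (rule interval_integral_FTC_integrable[where F = "\<lambda>k. F (Complex p k)"])
    show "((\<lambda>k. F (Complex p k)) has_vector_derivative \<i> * F' (Complex p x)) (at x)" for x
      using field_vector_diff_chain_at[OF Complex_has_vector_derivative_Im deriv, of p x] p
      by (simp add: o_def)
    have "continuous_on UNIV (\<lambda>k. \<i> * F' (Complex p k))"
      by (intro continuous_intros continuous_on_vertical[OF cont p])
    then show "isCont (\<lambda>k. \<i> * F' (Complex p k)) x" for x
      by (simp add: continuous_on_eq_continuous_at)
    show "set_integrable lborel (einterval (- \<infinity>) \<infinity>) (\<lambda>k. \<i> * F' (Complex p k))"
      using int by (simp add: set_integrable_def)
  qed (use lim in \<open>simp_all add: ereal_tendsto_simps\<close>)
  then show ?thesis
    by (simp add: interval_lebesgue_integral_def set_lebesgue_integral_def)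
qed

lemma integrable_mult_pair:
  fixes f g :: "real \<Rightarrow> real"
  assumes f: "integrable lborel f" and g: "integrable lborel g"
  shows "integrable (lborel \<Otimes>\<^sub>M lborel) (\<lambda>(x, y). f x * g y)"
proof -
  have [measurable]: "f \<in> borel_measurable borel" "g \<in> borel_measurable borel"
    using f g by auto
  show ?thesis
    by (rule lborel_pair.Fubini_integrable) (use f g in \<open>auto simp: abs_mult\<close>)
qed

text \<open>For k \<noteq> 0 the difference F (p + i k) - F (i k) is the integral of F' over a
  horizontal segment; after Fubini the inner integrals run along vertical lines and vanish.
  Continuity at the boundary is asked only for k \<noteq> 0, so that F may have a branch point at
  0.\<close>

lemma integral_vertical_eq_boundary:
  fixes F F' :: "complex \<Rightarrow> complex"
  assumes p: "0 < p"
    and deriv: "\<And>q. 0 < Re q \<Longrightarrow> (F has_field_derivative F' q) (at q)"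
    and cont: "continuous_on {q. 0 < Re q} F'"
    and bd: "\<And>k. k \<noteq> 0 \<Longrightarrow> isCont F (Complex 0 k)"
    and int0: "integrable lborel (\<lambda>k. F (Complex 0 k))"
    and bF: "\<And>t k. 0 < t \<Longrightarrow> t \<le> p \<Longrightarrow> norm (F (Complex t k)) \<le> C * exp (- \<bar>k\<bar>)"
    and bF': "\<And>t k. 0 < t \<Longrightarrow> t \<le> p \<Longrightarrow> norm (F' (Complex t k)) \<le> D * exp (- \<bar>k\<bar>)"
  shows "(\<integral>k. F (Complex p k) \<partial>lborel) = (\<integral>k. F (Complex 0 k) \<partial>lborel)"
proof -
  have contF: "continuous_on {q. 0 < Re q} F"
    by (intro continuous_at_imp_continuous_on ballI DERIV_isCont[OF deriv]) auto
  have intp: "integrable lborel (\<lambda>k. F (Complex p k))"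
    by (rule integrable_vertical[OF contF p bF]) (use p in auto)
  let ?G = "\<lambda>t k. indicator {0<..<p} t *\<^sub>R F' (Complex t k)"
  have D0: "0 \<le> D" using bF'[of p 0] p by (auto intro: order_trans[OF norm_ge_zero])
  have "continuous_on ({0<..<p} \<times> UNIV) (\<lambda>x. F' (Complex (fst x) (snd x)))"
    by (rule continuous_on_compose2[OF cont]) (auto intro!: continuous_intros)
  then have "(\<lambda>x. indicator ({0<..<p} \<times> UNIV) x *\<^sub>R F' (Complex (fst x) (snd x))) \<in> borel_measurable borel"
    by (intro borel_measurable_continuous_on_indicator)
       (auto intro!: borel_open open_Times)
  moreover have "(\<lambda>x. indicator ({0<..<p} \<times> UNIV) x *\<^sub>R F' (Complex (fst x) (snd x))) = (\<lambda>(t, k). ?G t k)"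
    by (auto simp: fun_eq_iff indicator_def)
  ultimately have meas: "(\<lambda>(t, k). ?G t k) \<in> borel_measurable (lborel \<Otimes>\<^sub>M lborel)"
    by (simp add: lborel_prod)
  have intG: "integrable (lborel \<Otimes>\<^sub>M lborel) (\<lambda>(t, k). ?G t k)"
  proof (rule Bochner_Integration.integrable_bound[OF _ meas])
    show "integrable (lborel \<Otimes>\<^sub>M lborel) (\<lambda>(t, k). (indicator {0<..<p} t :: real) * (D * exp (- \<bar>k\<bar>)))"
      by (rule integrable_mult_pair[OF _ integrable_mult_right[OF integrable_exp_neg_abs]])
         (use p in \<open>simp add: integrable_indicator_iff\<close>)
    show "AE x in lborel \<Otimes>\<^sub>M lborel. norm (case x of (t, k) \<Rightarrow> ?G t k)
        \<le> norm (case x of (t, k) \<Rightarrow> (indicator {0<..<p} t :: real) * (D * exp (- \<bar>k\<bar>)))"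
      using D0 bF' by (auto simp: indicator_def)
  qed
  have 1: "(\<integral>t. ?G t k \<partial>lborel) = F (Complex p k) - F (Complex 0 k)"
    if k: "k \<noteq> 0" and intk: "integrable lborel (\<lambda>t. ?G t k)" for k
  proof -
    have "(LBINT t=0..p. F' (Complex t k)) = F (Complex p k) - F (Complex 0 k)"
    proof (rule interval_integral_FTC_integrable[where F = "\<lambda>t. F (Complex t k)"])
      fix t assume "0 < ereal t" "ereal t < ereal p"
      then have t: "0 < t" "t < p" by auto
      show "((\<lambda>t. F (Complex t k)) has_vector_derivative F' (Complex t k)) (at t)"
        using field_vector_diff_chain_at[OF Complex_has_vector_derivative_Re deriv, of t k] t
        by (simp add: o_def)
      show "isCont (\<lambda>t. F' (Complex t k)) t"
      proof (rule continuous_on_interior[where S = "{0<..}"])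
        show "continuous_on {0<..} (\<lambda>t. F' (Complex t k))"
          by (rule continuous_on_compose2[OF cont]) (auto intro!: continuous_intros)
      qed (use t in \<open>simp add: interior_open\<close>)
    next
      show "set_integrable lborel (einterval 0 p) (\<lambda>t. F' (Complex t k))"
        using intk by (simp add: set_integrable_def zero_ereal_def)
    next
      have "isCont (\<lambda>t. F (Complex t k)) 0"
        by (rule isCont_o2[where g = F and f = "\<lambda>t. Complex t k"]) (auto intro!: has_vector_derivative_continuous[OF Complex_has_vector_derivative_Re] bd[OF k])
      then have "((\<lambda>t. F (Complex t k)) \<longlongrightarrow> F (Complex 0 k)) (at_right 0)"
        by (simp add: isCont_def filterlim_at_split)
      then show "(((\<lambda>t. F (Complex t k)) \<circ> real_of_ereal) \<longlongrightarrow> F (Complex 0 k)) (at_right 0)"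
        by (simp add: ereal_tendsto_simps zero_ereal_def)
    next
      have "isCont (\<lambda>t. F (Complex t k)) p"
        by (rule isCont_o2[where g = F and f = "\<lambda>t. Complex t k"])
           (use p in \<open>auto intro!: has_vector_derivative_continuous[OF Complex_has_vector_derivative_Re] DERIV_isCont[OF deriv]\<close>)
      then have "((\<lambda>t. F (Complex t k)) \<longlongrightarrow> F (Complex p k)) (at_left p)"
        by (simp add: isCont_def filterlim_at_split)
      then show "(((\<lambda>t. F (Complex t k)) \<circ> real_of_ereal) \<longlongrightarrow> F (Complex p k)) (at_left (ereal p))"
        by (simp add: ereal_tendsto_simps)
    qed (use p in simp)
    then show ?thesis
      using p by (simp add: interval_lebesgue_integral_def set_lebesgue_integral_def zero_ereal_def)
  qed
  have "(\<integral>k. F (Complex p k) - F (Complex 0 k) \<partial>lborel) = (\<integral>k. (\<integral>t. ?G t k \<partial>lborel) \<partial>lborel)"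
  proof (rule integral_cong_AE)
    \<comment> \<open>The identity on a horizontal segment holds for almost every k only: k = 0 may
      meet the branch point, and Fubini gives integrability in t off a null set.\<close>
    show "AE k in lborel. F (Complex p k) - F (Complex 0 k) = (\<integral>t. ?G t k \<partial>lborel)"
      using AE_lborel_singleton[of 0] lborel_pair.AE_integrable_snd[OF intG] by eventually_elim (simp add: 1)
    show "(\<lambda>k. F (Complex p k) - F (Complex 0 k)) \<in> borel_measurable lborel"
      using intp int0 by (intro borel_measurable_diff borel_measurable_integrable)
    show "(\<lambda>k. \<integral>t. ?G t k \<partial>lborel) \<in> borel_measurable lborel"
      using lborel_pair.integrable_snd[OF intG] by (rule borel_measurable_integrable)
  qed
  also have "\<dots> = (\<integral>t. (\<integral>k. ?G t k \<partial>lborel) \<partial>lborel)"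
    by (rule lborel_pair.Fubini_integral[OF intG])
  also have "\<dots> = (\<integral>t. 0 \<partial>(lborel::real measure))"
  proof (rule Bochner_Integration.integral_cong[OF refl])
    fix t :: real
    have "(\<integral>k. F' (Complex t k) \<partial>lborel) = 0" if "0 < t" "t < p"
      by (rule integral_vertical_derivative_zero[OF that(1) deriv cont bF bF']) (use that in auto)
    then show "(\<integral>k. ?G t k \<partial>lborel) = 0" by (auto simp: indicator_def)
  qed
  finally show ?thesis using intp int0 by simp
qed

section \<open>Gamma integrals with a complex parameter\<close>

lemma Gamma_absolute_integral:
  assumes "0 < (v::real)"
  shows "(\<lambda>t. t powr (v - 1) * exp (- t)) absolutely_integrable_on {0<..}"
    "integral {0<..} (\<lambda>t. t powr (v - 1) * exp (- t)) = Gamma v"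
proof -
  have "((\<lambda>t. t powr (v - 1) * exp (- t)) has_integral Gamma v) {0..}"
    using Gamma_integral_real[OF assms] by (simp add: exp_minus divide_inverse)
  then have "((\<lambda>t. t powr (v - 1) * exp (- t)) has_integral Gamma v) {0<..}"
    by (subst has_integral_spike_set_eq[where T = "{0..}"]) (auto intro: negligible_subset[of "{0}"])
  then show "(\<lambda>t. t powr (v - 1) * exp (- t)) absolutely_integrable_on {0<..}"
    "integral {0<..} (\<lambda>t. t powr (v - 1) * exp (- t)) = Gamma v"
    by (auto intro!: nonnegative_absolutely_integrable_1 simp: integral_unique)
qed

text \<open>Substitution t = x k^\<alpha> in Euler's integral for Gamma v; the exponents match
  because (\<alpha> - 1) + \<alpha> (v - 1) = s.\<close>

lemma powr_exp_integral_real: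
  fixes x \<alpha> s :: real
  assumes x: "0 < x" and \<alpha>: "0 < \<alpha>" and s: "-1 < s"
  defines "v \<equiv> (s + 1) / \<alpha>"
  shows "has_bochner_integral lborel (\<lambda>k. indicator {0<..} k * (k powr s * exp (- x * k powr \<alpha>)))
    (Gamma v * x powr (- v) / \<alpha>)"
proof -
  have v: "0 < v" using s \<alpha> by (simp add: v_def)
  let ?g = "\<lambda>k. x * k powr \<alpha>" and ?g' = "\<lambda>k. x * (\<alpha> * k powr (\<alpha> - 1))"
  let ?f = "\<lambda>t. t powr (v - 1) * exp (- t)"
  have img: "?g ` {0<..} = {0<..}"
  proof (intro equalityI subsetI)
    fix t :: real assume t: "t \<in> {0<..}"
    show "t \<in> ?g ` {0<..}"
      by (rule image_eqI[of _ _ "(t / x) powr (1 / \<alpha>)"]) (use t x \<alpha> in \<open>auto simp: powr_powr\<close>)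
  qed (use x in auto)
  have inj: "inj_on ?g {0<..}"
  proof (rule inj_onI)
    fix k l assume "k \<in> {0<..}" "l \<in> {0<..}" "?g k = ?g l"
    then have "0 < k" "0 < l" "(k powr \<alpha>) powr (1 / \<alpha>) = (l powr \<alpha>) powr (1 / \<alpha>)" using x by auto
    then show "k = l" using \<alpha> by (simp add: powr_powr)
  qed
  have m: "(\<lambda>k. \<bar>?g' k\<bar> * ?f (?g k)) absolutely_integrable_on {0<..} \<and>
      integral {0<..} (\<lambda>k. \<bar>?g' k\<bar> * ?f (?g k)) = Gamma v"
  proof (rule has_absolute_integral_change_of_variables_1'[where g = ?g and g' = ?g' and f = ?f and S = "{0<..}", THEN iffD2])
    show "(?g has_field_derivative ?g' k) (at k within {0<..})" if "k \<in> {0<..}" for k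
      using that by (auto intro!: derivative_eq_intros simp: powr_diff)
    show "?f absolutely_integrable_on ?g ` {0<..} \<and> integral (?g ` {0<..}) ?f = Gamma v"
      unfolding img using Gamma_absolute_integral[OF v] by blast
  qed (use inj in auto)
  have e: "\<bar>?g' k\<bar> * ?f (?g k) = (\<alpha> * x powr v) * (k powr s * exp (- x * k powr \<alpha>))"
    if "k \<in> {0<..}" for k
  proof -
    have k: "0 < k" using that by simp
    have "(\<alpha> - 1) + \<alpha> * (v - 1) = s" using \<alpha> by (simp add: v_def field_simps)
    then have "k powr (\<alpha> - 1) * (k powr \<alpha>) powr (v - 1) = k powr s"
      using k by (simp add: powr_powr powr_add[symmetric])
    moreover have "x * x powr (v - 1) = x powr v" using x by (simp add: powr_diff)
    moreover have "\<bar>?g' k\<bar> * ?f (?g k)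
        = \<alpha> * (x * x powr (v - 1)) * (k powr (\<alpha> - 1) * (k powr \<alpha>) powr (v - 1)) * exp (- x * k powr \<alpha>)"
      using x \<alpha> k by (simp add: powr_mult abs_mult)
    ultimately show ?thesis by simp
  qed
  have *: "set_integrable lebesgue {0<..} (\<lambda>k. (\<alpha> * x powr v) * (k powr s * exp (- x * k powr \<alpha>)))"
    using conjunct1[OF m] by (subst (asm) set_integrable_cong[OF refl refl e]) auto
  have **: "integral {0<..} (\<lambda>k. (\<alpha> * x powr v) * (k powr s * exp (- x * k powr \<alpha>))) = Gamma v"
    by (rule trans[OF Henstock_Kurzweil_Integration.integral_cong[OF e[symmetric]] conjunct2[OF m]])
  have "has_bochner_integral lebesgue (\<lambda>k. indicator {0<..} k *\<^sub>R ((\<alpha> * x powr v) * (k powr s * exp (- x * k powr \<alpha>)))) (Gamma v)"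
    using * trans[OF set_lebesgue_integral_eq_integral(2)[OF *] **]
    unfolding has_bochner_integral_iff set_integrable_def set_lebesgue_integral_def by blast
  then have "has_bochner_integral lborel (\<lambda>k. indicator {0<..} k *\<^sub>R ((\<alpha> * x powr v) * (k powr s * exp (- x * k powr \<alpha>)))) (Gamma v)"
    by (simp add: has_bochner_integral_iff integrable_completion integral_completion)
  from has_bochner_integral_divide[OF this, of "\<alpha> * x powr v"]
  show ?thesis using x \<alpha> by (simp add: powr_minus field_simps)
qed

text \<open>Puts the terms of the binomial series of (1 - y)^(-v) into the form in which the
  quotients Gamma (v + n) / Gamma v appear.\<close>

lemma gbinomial_neg_pochhammer:
  fixes v :: "'a::field_char_0"
  shows "(- v gchoose n) * (- y) ^ n = pochhammer v n / fact n * y ^ n"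
proof -
  have "(- y) ^ n = (- 1) ^ n * y ^ n" by (rule power_minus)
  then show ?thesis by (simp add: gbinomial_pochhammer)
qed

text \<open>Expanding around a real point \<open>x\<close> of the half plane that is closer to \<open>z\<close> than to \<open>0\<close>
  turns the integral into a binomial series.\<close>
lemma powr_exp_integral_complex:
  fixes z :: complex and \<alpha> s :: real
  assumes z: "0 < Re z" and \<alpha>: "0 < \<alpha>" and s: "-1 < s"
  defines "v \<equiv> (s + 1) / \<alpha>"
  shows "has_bochner_integral lborel
    (\<lambda>k. indicator {0<..} k *\<^sub>R (of_real (k powr s) * exp (- z * of_real (k powr \<alpha>))))
    (of_real (Gamma v) * z powr (- of_real v) / of_real \<alpha>)"
proof -
  have v: "0 < v" using s \<alpha> by (simp add: v_def)
  \<comment> \<open>For real x one has |x - z|^2 = x^2 - 2 x Re z + |z|^2, which is below x^2 once x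
    > |z|^2 / (2 Re z). Twice this bound is taken, and the gap is then exactly |z|^2.\<close>
  define x where "x = (norm z)\<^sup>2 / Re z"
  define w where "w = of_real x - z"
  have z0: "z \<noteq> 0" using z by auto
  have x: "0 < x" using z z0 by (simp add: x_def)
  have "(norm w)\<^sup>2 = x\<^sup>2 - 2 * x * Re z + (norm z)\<^sup>2"
    unfolding w_def cmod_power2 by (simp add: power2_eq_square algebra_simps)
  also have "\<dots> = x\<^sup>2 - (norm z)\<^sup>2" using z by (simp add: x_def)
  also have "\<dots> < x\<^sup>2" using z0 by simp
  finally have w: "norm w < x" using x by (simp add: power2_less_imp_less)
  \<comment> \<open>From exp (- z k^\<alpha>) = exp (- x k^\<alpha>) exp (w k^\<alpha>) with the
    second factor expanded. The n-th term is a real integral with s replaced by s + \<alpha> n, that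
    is, with v replaced by v + n.\<close>
  define f where "f = (\<lambda>n k. (indicator {0<..} k * (k powr (s + \<alpha> * real n) * exp (- x * k powr \<alpha>))) *\<^sub>R (w ^ n / fact n))"
  have vn: "(s + \<alpha> * real n + 1) / \<alpha> = v + real n" for n using \<alpha> by (simp add: v_def field_simps)
  have base: "has_bochner_integral lborel (\<lambda>k. indicator {0<..} k * (k powr (s + \<alpha> * real n) * exp (- x * k powr \<alpha>)))
      (Gamma (v + real n) * x powr (- (v + real n)) / \<alpha>)" for n
  proof -
    have "0 \<le> \<alpha> * real n" using \<alpha> by simp
    then have "-1 < s + \<alpha> * real n" using s by linarith
    from powr_exp_integral_real[OF x \<alpha> this] show ?thesis unfolding vn .
  qed
  have Gn: "Gamma (v + real n) * x powr (- (v + real n)) / \<alpha>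
      = (Gamma v * x powr (- v) / \<alpha>) * (pochhammer v n / x ^ n)" for n
  proof -
    have "Gamma (v + real n) = pochhammer v n * Gamma v"
      using pochhammer_Gamma[of v n] v by (simp add: Gamma_eq_zero_iff nonpos_Ints_def)
    moreover have "x powr (- (v + real n)) = x powr (- v) / x ^ n"
      using x by (simp add: powr_diff powr_realpow)
    ultimately show ?thesis by (simp add: mult_ac)
  qed
  have fint: "has_bochner_integral lborel (f n)
      (of_real (Gamma v * x powr (- v) / \<alpha>) * (pochhammer (of_real v) n / fact n * (w / of_real x) ^ n))" for n
    using has_bochner_integral_scaleR_left[OF base[of n], of "w ^ n / fact n"] unfolding Gn f_def
    by (simp add: scaleR_conv_of_real pochhammer_of_real power_divide mult_ac)
  have fnint: "has_bochner_integral lborel (\<lambda>k. norm (f n k))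
      ((Gamma v * x powr (- v) / \<alpha>) * (pochhammer v n / fact n * (norm w / x) ^ n))" for n
    using has_bochner_integral_mult_left[OF base[of n], of "norm w ^ n / fact n"] unfolding Gn f_def
    by (simp add: norm_power norm_divide power_divide mult_ac abs_mult)
  have f_sums: "(\<lambda>n. f n k) sums (indicator {0<..} k *\<^sub>R (of_real (k powr s) * exp (- z * of_real (k powr \<alpha>))))"
    and f_summable: "summable (\<lambda>n. norm (f n k))" for k
  proof -
    let ?y = "w * of_real (k powr \<alpha>)"
    have fe: "f n k = (indicator {0<..} k * (k powr s * exp (- x * k powr \<alpha>))) *\<^sub>R (?y ^ n /\<^sub>R fact n)" for n
    proof (cases "0 < k")
      case True
      then have "k powr (s + \<alpha> * real n) = k powr s * (k powr \<alpha>) ^ n"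
        by (simp add: powr_add powr_powr[symmetric] powr_realpow)
      then show ?thesis by (simp add: f_def scaleR_conv_of_real power_mult_distrib divide_inverse mult_ac)
    qed (simp add: f_def)
    have "(\<lambda>n. f n k) sums ((indicator {0<..} k * (k powr s * exp (- x * k powr \<alpha>))) *\<^sub>R exp ?y)"
      unfolding fe by (intro sums_scaleR_right exp_converges)
    also have "(indicator {0<..} k * (k powr s * exp (- x * k powr \<alpha>))) *\<^sub>R exp ?y
        = indicator {0<..} k *\<^sub>R (of_real (k powr s) * exp (- z * of_real (k powr \<alpha>)))"
    proof -
      have "of_real (exp (- x * k powr \<alpha>)) * exp ?y = exp (- z * of_real (k powr \<alpha>))"
        by (simp add: exp_of_real[symmetric] exp_add[symmetric] w_def algebra_simps)
      then show ?thesis by (simp add: scaleR_conv_of_real mult.assoc)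
    qed
    finally show "(\<lambda>n. f n k) sums \<dots>" .
    show "summable (\<lambda>n. norm (f n k))"
      unfolding fe
      using summable_mult[OF summable_norm_exp[of ?y], of "\<bar>indicator {0<..} k * (k powr s * exp (- x * k powr \<alpha>))\<bar>"]
      by (simp only: norm_scaleR)
  qed
  \<comment> \<open>The integrals of the absolute values form the real binomial series at |w| / x <
    1; this is what the choice of x secures.\<close>
  have "(\<lambda>n. (- v gchoose n) * (- (norm w / x)) ^ n) sums (1 + - (norm w / x)) powr (- v)"
    using w x by (intro gen_binomial_real) auto
  then have "summable (\<lambda>n. pochhammer v n / fact n * (norm w / x) ^ n)"
    unfolding gbinomial_neg_pochhammer by (rule sums_summable)
  then have summ: "summable (\<lambda>n. \<integral>k. norm (f n k) \<partial>lborel)"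
    using fnint by (subst has_bochner_integral_integral_eq[OF fnint]) (rule summable_mult)
  have int: "integrable lborel (f n)" for n using fint by (auto simp: has_bochner_integral_iff)
  have I: "integrable lborel (\<lambda>k. \<Sum>n. f n k)" "(\<lambda>n. \<integral>k. f n k \<partial>lborel) sums (\<integral>k. (\<Sum>n. f n k) \<partial>lborel)"
    using integrable_suminf[OF int AE_I2[OF f_summable] summ] sums_integral[OF int AE_I2[OF f_summable] summ] by auto
  have "(\<lambda>n. (- of_real v gchoose n) * (- (w / of_real x)) ^ n) sums (1 + - (w / of_real x)) powr (- of_real v)"
    using w x by (intro gen_binomial_complex) (simp add: norm_divide)
  then have "(\<lambda>n. of_real (Gamma v * x powr (- v) / \<alpha>) * (pochhammer (of_real v) n / fact n * (w / of_real x) ^ n))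
      sums (of_real (Gamma v * x powr (- v) / \<alpha>) * (1 + - (w / of_real x)) powr (- of_real v))"
    unfolding gbinomial_neg_pochhammer by (rule sums_mult)
  then have "(\<integral>k. (\<Sum>n. f n k) \<partial>lborel) = of_real (Gamma v * x powr (- v) / \<alpha>) * (1 + - (w / of_real x)) powr (- of_real v)"
    using I(2) by (simp add: has_bochner_integral_integral_eq[OF fint] sums_unique2)
  also have "1 + - (w / of_real x) = z / of_real x" using x by (simp add: w_def field_simps)
  also have "of_real (Gamma v * x powr (- v) / \<alpha>) * (z / of_real x) powr (- of_real v)
      = of_real (Gamma v) * z powr (- of_real v) / of_real \<alpha>"
  proof -
    have "z powr (- of_real v) = (of_real x * (z / of_real x)) powr (- of_real v)" using x by simp
    also have "\<dots> = of_real x powr (- of_real v) * (z / of_real x) powr (- of_real v)"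
      using x by (intro powr_times_real_left) auto
    also have "of_real x powr (- of_real v) = (of_real (x powr (- v)) :: complex)"
      using x powr_of_real[of x "- v"] by simp
    finally show ?thesis by simp
  qed
  finally show ?thesis
    using I(1) f_sums by (simp add: has_bochner_integral_iff sums_iff)
qed

section \<open>The stable exponential on the right half plane\<close>

text \<open>For c = - \<mu> \<tau> and real q > 0 this is the moment generating function of
  \<open>X \<tau>\<close>; spectral negativity is what makes it finite on the right half
  plane.\<close>

definition stable_exp :: "real \<Rightarrow> real \<Rightarrow> complex \<Rightarrow> complex" where
  "stable_exp \<alpha> c q = exp (of_real c * q powr of_real \<alpha>)"

lemma stable_exp_has_field_derivative:
  assumes "0 < Re q"
  shows "(stable_exp \<alpha> c has_field_derivative
    of_real (c * \<alpha>) * q powr of_real (\<alpha> - 1) * stable_exp \<alpha> c q) (at q)"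
  unfolding stable_exp_def
  by (rule derivative_eq_intros refl has_field_derivative_powr | use assms in \<open>simp add: complex_nonpos_Reals_iff\<close>)+

lemma continuous_on_powr_right_half_plane:
  "continuous_on {q. 0 < Re q} (\<lambda>q. q powr of_real s)"
  by (intro continuous_intros) auto

lemma continuous_on_powr_closed_half_plane:
  assumes "0 < s"
  shows "continuous_on {q. 0 \<le> Re q} (\<lambda>q. q powr of_real s)"
  using assms by (intro continuous_intros) auto

lemma continuous_on_stable_exp:
  assumes "0 < \<alpha>"
  shows "continuous_on {q. 0 \<le> Re q} (stable_exp \<alpha> c)"
  unfolding stable_exp_def by (intro continuous_intros continuous_on_powr_closed_half_plane assms)

lemma continuous_on_stable_exp_open:
  assumes "0 < \<alpha>"
  shows "continuous_on {q. 0 < Re q} (stable_exp \<alpha> c)"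
  by (rule continuous_on_subset[OF continuous_on_stable_exp[OF assms]]) auto

text \<open>The growth condition on h is imposed point by point inside the quantifiers, so that one
  statement covers a closed strip, an open strip and a single line.\<close>

lemma norm_mult_stable_exp_le:
  fixes h :: "complex \<Rightarrow> complex"
  assumes \<alpha>: "1 < \<alpha>" "\<alpha> \<le> 2" and c: "0 < c" and B: "0 \<le> B" and A: "0 \<le> A"
  shows "\<exists>C\<ge>0. \<forall>p k. 0 \<le> p \<longrightarrow> p \<le> P \<longrightarrow> norm (h (Complex p k)) \<le> A * exp (B * norm (Complex p k)) \<longrightarrow>
    norm (h (Complex p k) * stable_exp \<alpha> c (Complex p k)) \<le> C * exp (- \<bar>k\<bar>)"
proof -
  obtain C where C: "0 < C" "\<And>p k. 0 \<le> p \<Longrightarrow> p \<le> P \<Longrightarrow>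
     exp (B * norm (Complex p k)) * norm (stable_exp \<alpha> c (Complex p k)) \<le> C * exp (- \<bar>k\<bar>)"
    using exp_powr_bound[OF \<alpha> c B, of P] unfolding stable_exp_def by blast
  have "norm (h (Complex p k) * stable_exp \<alpha> c (Complex p k)) \<le> (A * C) * exp (- \<bar>k\<bar>)"
    if "0 \<le> p" "p \<le> P" "norm (h (Complex p k)) \<le> A * exp (B * norm (Complex p k))" for p k
  proof -
    have "norm (h (Complex p k) * stable_exp \<alpha> c (Complex p k))
        \<le> A * exp (B * norm (Complex p k)) * norm (stable_exp \<alpha> c (Complex p k))"
      unfolding norm_mult using that(3) by (rule mult_right_mono) simp
    also have "\<dots> \<le> A * (C * exp (- \<bar>k\<bar>))"
      unfolding mult.assoc using C(2)[OF that(1,2)] A by (rule mult_left_mono)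
    finally show ?thesis by (simp add: mult.assoc)
  qed
  then show ?thesis using A C(1) by (intro exI[of _ "A * C"]) auto
qed

lemma norm_powr_le_exp:
  fixes q :: complex
  assumes "0 \<le> s"
  shows "norm (q powr of_real s) \<le> exp (s * norm q)"
proof (cases "q = 0")
  case False
  have "norm (q powr of_real s) = norm q powr s" by (subst norm_powr_real_powr') auto
  also have "\<dots> = exp (s * ln (norm q))" using False by (simp add: powr_def)
  also have "\<dots> \<le> exp (s * norm q)" using assms False ln_bound[of "norm q"]
    by (auto intro!: mult_left_mono)
  finally show ?thesis .
qed auto

text \<open>A negative power is bounded away from 0 and a nonnegative one has exponential growth;
  the factor \<open>1 + p powr s\<close> covers both signs in one bound.\<close>

lemma norm_powr_le_of_norm_ge:
  fixes q :: complex
  assumes "0 < p" "p \<le> norm q"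
  shows "norm (q powr of_real s) \<le> (1 + p powr s) * exp (\<bar>s\<bar> * norm q)"
proof (cases "0 \<le> s")
  case True
  have "norm (q powr of_real s) \<le> 1 * exp (\<bar>s\<bar> * norm q)" using norm_powr_le_exp[OF True] True by simp
  also have "\<dots> \<le> (1 + p powr s) * exp (\<bar>s\<bar> * norm q)" by (intro mult_right_mono) auto
  finally show ?thesis .
next
  case False
  have "norm (q powr of_real s) = norm q powr s" by (subst norm_powr_real_powr') auto
  also have "\<dots> \<le> p powr s" using False assms by (intro powr_mono2') auto
  also have "\<dots> \<le> (1 + p powr s) * 1" by simp
  also have "\<dots> \<le> (1 + p powr s) * exp (\<bar>s\<bar> * norm q)" by (intro mult_left_mono) auto
  finally show ?thesis .
qed

lemma powr_stable_exp_bound: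
  assumes \<alpha>: "1 < \<alpha>" "\<alpha> \<le> 2" and c: "0 < c" and p: "0 < p"
  shows "\<exists>C. \<forall>k. norm (Complex p k powr of_real s * stable_exp \<alpha> c (Complex p k)) \<le> C * exp (- \<bar>k\<bar>)"
proof -
  have "norm (Complex p k powr of_real s) \<le> (1 + p powr s) * exp (\<bar>s\<bar> * norm (Complex p k))" for k
    using abs_Re_le_cmod[of "Complex p k"] p by (intro norm_powr_le_of_norm_ge) auto
  then show ?thesis
    using norm_mult_stable_exp_le[OF \<alpha> c, of "\<bar>s\<bar>" "1 + p powr s" p "\<lambda>q. q powr of_real s"] p
    by (meson abs_ge_zero add_nonneg_nonneg less_imp_le order_refl powr_ge_zero zero_le_one)
qed

lemma integrable_powr_stable_exp:
  assumes \<alpha>: "1 < \<alpha>" "\<alpha> \<le> 2" and c: "0 < c" and p: "0 < p"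
  shows "integrable lborel (\<lambda>k. Complex p k powr of_real s * stable_exp \<alpha> c (Complex p k))"
proof -
  obtain C where C: "\<And>k. norm (Complex p k powr of_real s * stable_exp \<alpha> c (Complex p k)) \<le> C * exp (- \<bar>k\<bar>)"
    using powr_stable_exp_bound[OF assms] by blast
  show ?thesis
    by (rule integrable_vertical[where F = "\<lambda>q. q powr of_real s * stable_exp \<alpha> c q", OF _ p C])
       (use \<alpha> in \<open>intro continuous_on_mult continuous_on_powr_right_half_plane continuous_on_stable_exp_open; simp\<close>)
qed

text \<open>Integration by parts: the derivative of q^(s + 1) exp (c q^\<alpha>) integrates to zero
  over the line. At s = -1 the left side is 0 and the identity says nothing about the integral it
  multiplies.\<close>

lemma powr_stable_exp_recurrence:
  assumes \<alpha>: "1 < \<alpha>" "\<alpha> \<le> 2" and c: "0 < c" and p: "0 < p"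
  shows "of_real (s + 1) * (\<integral>k. Complex p k powr of_real s * stable_exp \<alpha> c (Complex p k) \<partial>lborel)
    = - of_real (c * \<alpha>) * (\<integral>k. Complex p k powr of_real (s + \<alpha>) * stable_exp \<alpha> c (Complex p k) \<partial>lborel)"
proof -
  let ?I = "\<lambda>s q. q powr of_real s * stable_exp \<alpha> c q"
  let ?F' = "\<lambda>q. of_real (s + 1) * ?I s q + of_real (c * \<alpha>) * ?I (s + \<alpha>) q"
  obtain C where C: "\<And>k. norm (?I (s + 1) (Complex p k)) \<le> C * exp (- \<bar>k\<bar>)"
    using powr_stable_exp_bound[OF assms] by blast
  obtain C1 where C1: "\<And>k. norm (?I s (Complex p k)) \<le> C1 * exp (- \<bar>k\<bar>)"
    using powr_stable_exp_bound[OF assms] by blast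
  obtain C2 where C2: "\<And>k. norm (?I (s + \<alpha>) (Complex p k)) \<le> C2 * exp (- \<bar>k\<bar>)"
    using powr_stable_exp_bound[OF assms] by blast
  have "(\<integral>k. ?F' (Complex p k) \<partial>lborel) = 0"
  proof (rule integral_vertical_derivative_zero[where F = "?I (s + 1)", OF p _ _ C])
    fix q :: complex assume q: "0 < Re q"
    then have q': "q \<notin> \<real>\<^sub>\<le>\<^sub>0" by (simp add: complex_nonpos_Reals_iff)
    have "(?I (s + 1) has_field_derivative
        of_real (s + 1) * q powr (of_real (s + 1) - 1) * stable_exp \<alpha> c q
        + of_real (c * \<alpha>) * q powr of_real (\<alpha> - 1) * stable_exp \<alpha> c q * q powr of_real (s + 1)) (at q)"
      by (rule DERIV_mult[OF has_field_derivative_powr[OF q'] stable_exp_has_field_derivative[OF q]])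
    moreover have "q powr (of_real (s + 1) - 1) = q powr of_real s" by simp
    moreover have "q powr of_real (\<alpha> - 1) * q powr of_real (s + 1) = q powr of_real (s + \<alpha>)"
      by (simp flip: powr_add add: algebra_simps)
    ultimately show "(?I (s + 1) has_field_derivative ?F' q) (at q)"
      by (simp add: mult_ac)
  next
    show "continuous_on {q. 0 < Re q} ?F'"
      using \<alpha> by (intro continuous_intros continuous_on_powr_right_half_plane continuous_on_stable_exp_open) auto
    fix k
    have "norm (?F' (Complex p k)) \<le> \<bar>s + 1\<bar> * norm (?I s (Complex p k)) + \<bar>c * \<alpha>\<bar> * norm (?I (s + \<alpha>) (Complex p k))"
      by (rule order_trans[OF norm_triangle_ineq]) (simp only: norm_mult norm_of_real order_refl)
    also have "\<dots> \<le> \<bar>s + 1\<bar> * (C1 * exp (- \<bar>k\<bar>)) + \<bar>c * \<alpha>\<bar> * (C2 * exp (- \<bar>k\<bar>))"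
      by (intro add_mono mult_left_mono C1 C2) auto
    finally show "norm (?F' (Complex p k)) \<le> (\<bar>s + 1\<bar> * C1 + \<bar>c * \<alpha>\<bar> * C2) * exp (- \<bar>k\<bar>)"
      by (simp add: algebra_simps)
  qed
  then have "of_real (s + 1) * (\<integral>k. ?I s (Complex p k) \<partial>lborel)
      + of_real (c * \<alpha>) * (\<integral>k. ?I (s + \<alpha>) (Complex p k) \<partial>lborel) = 0"
    by (subst (asm) Bochner_Integration.integral_add)
       (use integrable_powr_stable_exp[OF assms] in \<open>simp_all del: of_real_add of_real_mult\<close>)
  then show ?thesis by (simp add: add_eq_0_iff2)
qed

text \<open>The form of the line shift for factors h of at most exponential growth. It is applied to
  powers q^s, for the Hankel integrals, and to exp (- q x), for the density.\<close>

lemma vertical_integral_stable_exp_eq_boundary: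
  fixes h h' :: "complex \<Rightarrow> complex"
  assumes \<alpha>: "1 < \<alpha>" "\<alpha> \<le> 2" and c: "0 < c" and p: "0 < p" and A: "0 \<le> A" and B: "0 \<le> B"
    and deriv: "\<And>q. 0 < Re q \<Longrightarrow> (h has_field_derivative h' q) (at q)"
    and cont': "continuous_on {q. 0 < Re q} h'"
    and cont: "continuous_on {q. 0 \<le> Re q} h"
    and bd: "\<And>k. k \<noteq> 0 \<Longrightarrow> isCont h (Complex 0 k)"
    and bh: "\<And>q. 0 \<le> Re q \<Longrightarrow> norm (h q) \<le> A * exp (B * norm q)"
    and bh': "\<And>q. 0 < Re q \<Longrightarrow> norm (h' q) \<le> A * exp (B * norm q)"
  shows "integrable lborel (\<lambda>k. h (Complex 0 k) * stable_exp \<alpha> c (Complex 0 k))"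
    and "(\<integral>k. h (Complex p k) * stable_exp \<alpha> c (Complex p k) \<partial>lborel)
      = (\<integral>k. h (Complex 0 k) * stable_exp \<alpha> c (Complex 0 k) \<partial>lborel)"
proof -
  \<comment> \<open>\<open>?g\<close> is the factor for which the derivative of h times
    \<open>stable_exp\<close> is \<open>?g\<close> times \<open>stable_exp\<close>. Its growth rate
    is B + 1, because |q^(\<alpha> - 1)| \<le> exp ((\<alpha> - 1) |q|) \<le> exp |q|.\<close>
  let ?g = "\<lambda>q. h' q + of_real (c * \<alpha>) * q powr of_real (\<alpha> - 1) * h q"
  let ?A' = "A + c * \<alpha> * A"
  have bg: "norm (?g q) \<le> ?A' * exp ((B + 1) * norm q)" if q: "0 < Re q" for q
  proof -
    have 1: "norm (h' q) \<le> A * exp ((B + 1) * norm q)"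
      by (rule order_trans[OF bh'[OF q]]) (use A in \<open>auto intro!: mult_left_mono mult_right_mono\<close>)
    have "norm (q powr of_real (\<alpha> - 1) * h q) \<le> exp ((\<alpha> - 1) * norm q) * (A * exp (B * norm q))"
      unfolding norm_mult using norm_powr_le_exp[of "\<alpha> - 1" q] bh[of q] \<alpha> q by (intro mult_mono) auto
    also have "\<dots> \<le> exp (norm q) * (A * exp (B * norm q))"
      using \<alpha> A by (intro mult_right_mono) (auto intro: mult_left_le_one_le)
    also have "\<dots> = A * exp ((B + 1) * norm q)" by (simp add: distrib_right exp_add)
    finally have 2: "norm (q powr of_real (\<alpha> - 1) * h q) \<le> A * exp ((B + 1) * norm q)" .
    have "norm (?g q) \<le> norm (h' q) + c * \<alpha> * norm (q powr of_real (\<alpha> - 1) * h q)"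
      by (rule order_trans[OF norm_triangle_ineq]) (use c \<alpha> in \<open>simp add: norm_mult\<close>)
    also have "\<dots> \<le> A * exp ((B + 1) * norm q) + c * \<alpha> * (A * exp ((B + 1) * norm q))"
      using c \<alpha> by (intro add_mono mult_left_mono 1 2) auto
    finally show ?thesis by (simp add: algebra_simps)
  qed
  obtain C where C0: "\<forall>t k. 0 \<le> t \<longrightarrow> t \<le> p \<longrightarrow> norm (h (Complex t k)) \<le> A * exp (B * norm (Complex t k)) \<longrightarrow>
      norm (h (Complex t k) * stable_exp \<alpha> c (Complex t k)) \<le> C * exp (- \<bar>k\<bar>)"
    using norm_mult_stable_exp_le[OF \<alpha> c B A, of p h] by blast
  have C: "norm (h (Complex t k) * stable_exp \<alpha> c (Complex t k)) \<le> C * exp (- \<bar>k\<bar>)"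
    if "0 \<le> t" "t \<le> p" for t k
    using C0 that bh[of "Complex t k"] by simp
  have B': "0 \<le> B + 1" and A': "0 \<le> ?A'" using A B c \<alpha> by auto
  obtain D where D0: "\<forall>t k. 0 \<le> t \<longrightarrow> t \<le> p \<longrightarrow> norm (?g (Complex t k)) \<le> ?A' * exp ((B + 1) * norm (Complex t k)) \<longrightarrow>
      norm (?g (Complex t k) * stable_exp \<alpha> c (Complex t k)) \<le> D * exp (- \<bar>k\<bar>)"
    using norm_mult_stable_exp_le[OF \<alpha> c B' A', of p ?g] by blast
  have D: "norm (?g (Complex t k) * stable_exp \<alpha> c (Complex t k)) \<le> D * exp (- \<bar>k\<bar>)"
    if "0 < t" "t \<le> p" for t k
    using D0[rule_format, of t k] that bg[of "Complex t k"] by simp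
  have "continuous_on UNIV (\<lambda>k. h (Complex 0 k) * stable_exp \<alpha> c (Complex 0 k))"
    using \<alpha> by (intro continuous_on_mult continuous_on_compose2[OF cont]
        continuous_on_compose2[OF continuous_on_stable_exp]) (auto intro!: continuous_intros)
  then show int0: "integrable lborel (\<lambda>k. h (Complex 0 k) * stable_exp \<alpha> c (Complex 0 k))"
    by (intro integrable_exp_abs_bound[OF borel_measurable_continuous_onI C]) (use p in auto)
  show "(\<integral>k. h (Complex p k) * stable_exp \<alpha> c (Complex p k) \<partial>lborel)
      = (\<integral>k. h (Complex 0 k) * stable_exp \<alpha> c (Complex 0 k) \<partial>lborel)"
  proof (rule integral_vertical_eq_boundary[where F = "\<lambda>q. h q * stable_exp \<alpha> c q"
        and F' = "\<lambda>q. ?g q * stable_exp \<alpha> c q", OF p _ _ _ int0 C D])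
    fix q :: complex assume q: "0 < Re q"
    show "((\<lambda>q. h q * stable_exp \<alpha> c q) has_field_derivative ?g q * stable_exp \<alpha> c q) (at q)"
      using DERIV_mult[OF deriv[OF q] stable_exp_has_field_derivative[OF q, of \<alpha> c]]
      by (simp add: algebra_simps)
  next
    have "continuous_on {q. 0 < Re q} h" by (rule continuous_on_subset[OF cont]) auto
    then show "continuous_on {q. 0 < Re q} (\<lambda>q. ?g q * stable_exp \<alpha> c q)"
      using \<alpha> cont' by (intro continuous_intros continuous_on_powr_right_half_plane continuous_on_stable_exp_open) auto
  next
    fix k :: real assume k: "k \<noteq> 0"
    then show "isCont (\<lambda>q. h q * stable_exp \<alpha> c q) (Complex 0 k)"
      unfolding stable_exp_def
      by (intro continuous_intros bd) (auto simp: complex_nonpos_Reals_iff)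
  qed auto
qed

section \<open>Hankel integrals\<close>

lemma has_bochner_integral_split_at_0:
  fixes f :: "real \<Rightarrow> complex"
  assumes "has_bochner_integral lborel (\<lambda>k. indicator {0<..} k *\<^sub>R f k) a"
    and "has_bochner_integral lborel (\<lambda>k. indicator {0<..} k *\<^sub>R f (- k)) b"
    and f: "f \<in> borel_measurable borel"
  shows "(\<integral>k. f k \<partial>lborel) = a + b"
proof -
  have 1: "has_bochner_integral lborel (\<lambda>k. indicator {0<..} (- k) *\<^sub>R f k) b"
    using lborel_has_bochner_integral_real_affine_iff[of "-1" "\<lambda>k. indicator {0<..} k *\<^sub>R f (- k)" b 0] assms(2)
    by simp
  have "AE k in lborel. f k = indicator {0<..} k *\<^sub>R f k + indicator {0<..} (- k) *\<^sub>R f k"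
    using AE_lborel_singleton[of 0] by eventually_elim (auto simp: indicator_def)
  moreover have "has_bochner_integral lborel (\<lambda>k. indicator {0<..} k *\<^sub>R f k + indicator {0<..} (- k) *\<^sub>R f k) (a + b)"
    by (rule has_bochner_integral_add[OF assms(1) 1])
  ultimately have "has_bochner_integral lborel f (a + b)"
    using f by (subst has_bochner_integral_cong_AE) (auto dest: borel_measurable_has_bochner_integral)
  then show ?thesis by (rule has_bochner_integral_integral_eq)
qed

text \<open>Euler's reflection formula, stated with \<open>rGamma\<close> so that it stays true at
  positive integers v, where both sides vanish.\<close>

lemma Gamma_mult_sin_eq_rGamma:
  fixes v :: real
  assumes "0 < v"
  shows "Gamma v * sin (pi * v) / pi = rGamma (1 - v)"
proof -
  have "complex_of_real (rGamma v * rGamma (1 - v)) = of_real (sin (pi * v) / pi)"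
    using rGamma_reflection_complex[of "of_real v"] rGamma_complex_of_real[of "1 - v"] sin_of_real[of "pi * v", where 'a = complex]
    by (simp add: rGamma_complex_of_real)
  then have "rGamma v * rGamma (1 - v) = sin (pi * v) / pi" unfolding of_real_eq_iff .
  moreover have "Gamma v * rGamma v = 1"
    using Gamma_real_pos[OF assms] by (simp add: rGamma_inverse_Gamma)
  ultimately show ?thesis by (metis mult.assoc mult.commute mult.left_neutral times_divide_eq_right)
qed

text \<open>The value predicted by Hankel's formula: with w = c q^\<alpha> and v = (s + 1) /
  \<alpha> the integral of q^s exp (c q^\<alpha>) becomes that of w^(v - 1) exp w, up to the factor
  c^(-v) / \<alpha>. The factor 2 pi appears because the integration is over k = Im q.\<close>

definition stable_line_integral :: "real \<Rightarrow> real \<Rightarrow> real \<Rightarrow> real" where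
  "stable_line_integral \<alpha> c s = 2 * pi * (c powr (- ((s + 1) / \<alpha>)) * rGamma (1 - (s + 1) / \<alpha>) / \<alpha>)"

text \<open>The two half lines carry Gamma integrals with the conjugate parameters z and
  \<open>cnj z\<close>, so the total is twice a real part. Its phase turns Gamma v into Gamma v sin
  (pi v), and reflection yields 1/Gamma.\<close>

lemma boundary_integral_powr_stable_exp:
  assumes \<alpha>: "1 < \<alpha>" "\<alpha> \<le> 2" and c: "0 < c" and s: "0 < s"
  shows "(\<integral>k. Complex 0 k powr of_real s * stable_exp \<alpha> c (Complex 0 k) \<partial>lborel) = of_real (stable_line_integral \<alpha> c s)"
proof -
  define v where "v = (s + 1) / \<alpha>"
  have v: "0 < v" using s \<alpha> by (simp add: v_def)
  let ?\<theta> = "pi * \<alpha> / 2"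
  \<comment> \<open>Chosen so that c (i k)^\<alpha> = - z k^\<alpha> for k > 0. The minus sign is
    written as a rotation by - pi, which puts the argument into (- pi / 2, 0]: the real part is
    positive and the principal logarithm can be read off.\<close>
  define z where "z = of_real c * cis (?\<theta> - pi)"
  have ze: "z = - of_real c * cis ?\<theta>"
    by (simp add: z_def complex_eq_iff)
  have Rz: "0 < Re z" using cos_half_pi_neg[OF \<alpha>] c by (simp add: ze mult_pos_neg)
  have Rcz: "0 < Re (cnj z)" using Rz by simp
  have Lnz: "Ln z = of_real (ln c) + \<i> * of_real (?\<theta> - pi)"
  proof (rule Ln_unique)
    show "exp (of_real (ln c) + \<i> * of_real (?\<theta> - pi)) = z"
      using c by (simp only: z_def exp_add cis_conv_exp exp_of_real exp_ln)
    have "pi * \<alpha> \<le> pi * 2" "0 < pi * \<alpha>" using \<alpha> by auto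
    then show "- pi < Im (of_real (ln c) + \<i> * of_real (?\<theta> - pi))"
      "Im (of_real (ln c) + \<i> * of_real (?\<theta> - pi)) \<le> pi"
      using pi_gt_zero by (simp_all del: mult_le_cancel_left_pos)
  qed
  have z0: "z \<noteq> 0" using Rz by auto
  have zp: "z powr (- of_real v) = of_real (c powr (- v)) * cis (- v * (?\<theta> - pi))"
  proof -
    have "z powr (- of_real v) = exp (of_real (- v * ln c) + \<i> * of_real (- v * (?\<theta> - pi)))"
      using z0 by (simp add: powr_def Lnz algebra_simps)
    also have "\<dots> = exp (of_real (- v * ln c)) * exp (\<i> * of_real (- v * (?\<theta> - pi)))"
      by (rule exp_add)
    also have "exp (of_real (- v * ln c)) = complex_of_real (c powr (- v))"
      using c by (simp add: powr_def exp_of_real[symmetric])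
    finally show ?thesis unfolding cis_conv_exp .
  qed
  have czp: "cnj z powr (- of_real v) = cnj (z powr (- of_real v))"
    using Rz by (subst cnj_powr) (auto simp: complex_nonpos_Reals_iff)
  let ?f = "\<lambda>k. Complex 0 k powr of_real s * stable_exp \<alpha> c (Complex 0 k)"
  let ?I = "of_real (Gamma v) * z powr (- of_real v) / of_real \<alpha>"
  have s1: "-1 < s" and a0: "0 < \<alpha>" using s \<alpha> by auto
  have f1: "?f k = cis (pi * s / 2) * (of_real (k powr s) * exp (- z * of_real (k powr \<alpha>)))" if "0 < k" for k
    using that by (simp add: stable_exp_def imaginary_powr ze mult_ac)
  have f2: "?f (- k) = cis (- (pi * s / 2)) * (of_real (k powr s) * exp (- cnj z * of_real (k powr \<alpha>)))" if "0 < k" for k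
    using that by (simp add: stable_exp_def imaginary_powr_neg ze cis_cnj mult_ac)
  have 1: "has_bochner_integral lborel (\<lambda>k. indicator {0<..} k *\<^sub>R ?f k) (cis (pi * s / 2) * ?I)"
  proof (rule has_bochner_integral_cong[THEN iffD1, OF refl _ refl])
    show "has_bochner_integral lborel
      (\<lambda>k. cis (pi * s / 2) * (indicator {0<..} k *\<^sub>R (of_real (k powr s) * exp (- z * of_real (k powr \<alpha>)))))
      (cis (pi * s / 2) * ?I)"
      using powr_exp_integral_complex[OF Rz a0 s1] unfolding v_def by (rule has_bochner_integral_mult_right)
  qed (auto simp: indicator_def f1)
  have 2: "has_bochner_integral lborel (\<lambda>k. indicator {0<..} k *\<^sub>R ?f (- k)) (cis (- (pi * s / 2)) * cnj ?I)"
  proof (rule has_bochner_integral_cong[THEN iffD1, OF refl _ refl])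
    show "has_bochner_integral lborel
      (\<lambda>k. cis (- (pi * s / 2)) * (indicator {0<..} k *\<^sub>R (of_real (k powr s) * exp (- cnj z * of_real (k powr \<alpha>)))))
      (cis (- (pi * s / 2)) * cnj ?I)"
      using has_bochner_integral_mult_right[OF powr_exp_integral_complex[OF Rcz a0 s1], of "cis (- (pi * s / 2))"]
      unfolding v_def[symmetric] by (simp add: czp)
  qed (auto simp: indicator_def f2)
  have "continuous_on UNIV ?f"
    using \<alpha> s by (intro continuous_on_mult continuous_on_compose2[OF continuous_on_powr_closed_half_plane]
        continuous_on_compose2[OF continuous_on_stable_exp]) (auto intro!: continuous_intros)
  then have "(\<integral>k. ?f k \<partial>lborel) = cis (pi * s / 2) * ?I + cis (- (pi * s / 2)) * cnj ?I"
    by (intro has_bochner_integral_split_at_0 1 2 borel_measurable_continuous_onI)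
  also have "cis (- (pi * s / 2)) * cnj ?I = cnj (cis (pi * s / 2) * ?I)" by (simp add: cis_cnj)
  also have "cis (pi * s / 2) * ?I + cnj (cis (pi * s / 2) * ?I) = of_real (2 * Re (cis (pi * s / 2) * ?I))"
    by (rule complex_add_cnj)
  also have "cis (pi * s / 2) * ?I = of_real (Gamma v * c powr (- v) / \<alpha>) * (cis (pi * s / 2) * cis (- v * (?\<theta> - pi)))"
    unfolding zp by simp
  \<comment> \<open>Since v \<alpha> = s + 1, the phases add up to pi v - pi / 2, and the cosine of
    this is sin (pi v).\<close>
  also have "cis (pi * s / 2) * cis (- v * (?\<theta> - pi)) = cis (pi * v - pi / 2)"
  proof -
    have "v * ?\<theta> = pi * (s + 1) / 2" using \<alpha> by (simp add: v_def field_simps)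
    then have "pi * s / 2 + - v * (?\<theta> - pi) = pi * v - pi / 2" by (simp add: algebra_simps) (simp add: field_simps)
    then show ?thesis by (simp add: cis_mult)
  qed
  also have "2 * Re (of_real (Gamma v * c powr (- v) / \<alpha>) * cis (pi * v - pi / 2))
      = 2 * pi * (c powr (- v) * (Gamma v * sin (pi * v) / pi) / \<alpha>)"
    by (simp add: cos_diff)
  also have "\<dots> = stable_line_integral \<alpha> c s"
    using Gamma_mult_sin_eq_rGamma[OF v] by (simp add: stable_line_integral_def v_def)
  finally show ?thesis .
qed

text \<open>The bound s \<ge> 1 keeps the derivative s q^(s - 1) bounded near 0, as the shift to the
  imaginary axis demands.\<close>

lemma vertical_integral_powr_stable_exp_ge_1:
  assumes \<alpha>: "1 < \<alpha>" "\<alpha> \<le> 2" and c: "0 < c" and p: "0 < p" and s: "1 \<le> s"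
  shows "(\<integral>k. Complex p k powr of_real s * stable_exp \<alpha> c (Complex p k) \<partial>lborel) = of_real (stable_line_integral \<alpha> c s)"
proof -
  have "(\<integral>k. Complex p k powr of_real s * stable_exp \<alpha> c (Complex p k) \<partial>lborel)
    = (\<integral>k. Complex 0 k powr of_real s * stable_exp \<alpha> c (Complex 0 k) \<partial>lborel)"
  proof (rule vertical_integral_stable_exp_eq_boundary(2)[where h' = "\<lambda>q. of_real s * q powr of_real (s - 1)"
        and A = s and B = s, OF \<alpha> c p])
    fix q :: complex
    show "((\<lambda>q. q powr of_real s) has_field_derivative of_real s * q powr of_real (s - 1)) (at q)" if "0 < Re q"
      using has_field_derivative_powr[of q "of_real s"] that by (simp add: complex_nonpos_Reals_iff)
    have "norm (q powr of_real s) \<le> 1 * exp (s * norm q)" using norm_powr_le_exp[of s q] s by simp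
    also have "\<dots> \<le> s * exp (s * norm q)" using s by (intro mult_right_mono) auto
    finally show "norm (q powr of_real s) \<le> s * exp (s * norm q)" .
    have "norm (q powr of_real (s - 1)) \<le> exp ((s - 1) * norm q)" using s by (intro norm_powr_le_exp) auto
    also have "\<dots> \<le> exp (s * norm q)" by (auto intro: mult_right_mono)
    finally show "norm (of_real s * q powr of_real (s - 1)) \<le> s * exp (s * norm q)"
      using s by (simp add: norm_mult mult_left_mono)
  next
    show "continuous_on {q. 0 < Re q} (\<lambda>q. of_real s * q powr of_real (s - 1))"
      by (intro continuous_intros continuous_on_powr_right_half_plane)
    show "continuous_on {q. 0 \<le> Re q} (\<lambda>q. q powr of_real s)"
      using s by (intro continuous_on_powr_closed_half_plane) auto
    show "isCont (\<lambda>q. q powr of_real s) (Complex 0 k)" if "k \<noteq> 0" for k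
      using that by (intro continuous_intros) (auto simp: complex_nonpos_Reals_iff)
  qed (use s in auto)
  also have "\<dots> = of_real (stable_line_integral \<alpha> c s)"
    using s by (intro boundary_integral_powr_stable_exp \<alpha> c) auto
  finally show ?thesis .
qed

text \<open>The functional equation of 1/Gamma, in the same shape as the integration by parts for
  the line integrals.\<close>

lemma stable_line_integral_recurrence:
  assumes "0 < \<alpha>" "0 < c"
  shows "(s + 1) * stable_line_integral \<alpha> c s = - (c * \<alpha>) * stable_line_integral \<alpha> c (s + \<alpha>)"
proof -
  define v where "v = (s + 1) / \<alpha>"
  have s: "s + 1 = \<alpha> * v" using assms by (simp add: v_def)
  have "(s + \<alpha> + 1) / \<alpha> = v + 1" using assms by (simp add: v_def field_simps)
  moreover have "c powr (- (v + 1)) = c powr (- v) / c" using assms by (simp add: powr_diff)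
  moreover have "rGamma (1 - (v + 1)) = - v * rGamma (1 - v)"
    using rGamma_plus1[of "- v"] by (simp add: add.commute)
  ultimately show ?thesis using assms by (simp add: stable_line_integral_def s)
qed

text \<open>Dominated convergence towards s = -1. The exponents lie in (-1, -1/2], so |q|^s \<le> 1
  + 1/p holds on the whole line, uniformly in n.\<close>

lemma vertical_integral_powr_stable_exp_continuous:
  assumes \<alpha>: "1 < \<alpha>" "\<alpha> \<le> 2" and c: "0 < c" and p: "0 < p"
  shows "(\<lambda>n. \<integral>k. Complex p k powr of_real (-1 + 1 / (real n + 2)) * stable_exp \<alpha> c (Complex p k) \<partial>lborel)
     \<longlonglongrightarrow> (\<integral>k. Complex p k powr of_real (-1) * stable_exp \<alpha> c (Complex p k) \<partial>lborel)"
proof (rule integral_dominated_convergence[where w = "\<lambda>k. (1 + 1 / p) * norm (stable_exp \<alpha> c (Complex p k))"])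
  let ?s = "\<lambda>n. -1 + 1 / (real n + 2)"
  have lim: "?s \<longlonglongrightarrow> -1"
    using tendsto_add[OF tendsto_const LIMSEQ_ignore_initial_segment[OF lim_1_over_n, of 2], of "-1"]
    by (simp add: add.commute)
  have "integrable lborel (\<lambda>k. stable_exp \<alpha> c (Complex p k))"
    using integrable_powr_stable_exp[OF assms, of 0] p by (simp add: complex_eq_iff)
  then show "integrable lborel (\<lambda>k. (1 + 1 / p) * norm (stable_exp \<alpha> c (Complex p k)))"
    by (intro integrable_mult_right integrable_norm)
  have q0: "Complex p k \<noteq> 0" "Complex p k \<notin> \<real>\<^sub>\<le>\<^sub>0" for k
    using p by (auto simp: complex_eq_iff complex_nonpos_Reals_iff)
  show "AE k in lborel. (\<lambda>n. Complex p k powr of_real (?s n) * stable_exp \<alpha> c (Complex p k))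
      \<longlonglongrightarrow> Complex p k powr of_real (-1) * stable_exp \<alpha> c (Complex p k)"
    by (intro AE_I2 tendsto_mult tendsto_powr_complex tendsto_const tendsto_of_real lim q0)
  fix n
  have bnd: "norm (Complex p k powr of_real (?s n)) \<le> 1 + 1 / p" for k
  proof -
    let ?r = "norm (Complex p k)"
    have r: "p \<le> ?r" using abs_Re_le_cmod[of "Complex p k"] by simp
    have s: "-1 \<le> ?s n" "?s n \<le> 0" by (auto simp: field_simps)
    have e: "norm (Complex p k powr of_real (?s n)) = ?r powr ?s n" by (subst norm_powr_real_powr') auto
    show ?thesis
    proof (cases "1 \<le> ?r")
      case True
      then have "?r powr ?s n \<le> ?r powr 0" using s by (intro powr_mono) auto
      then have "?r powr ?s n \<le> 1" using q0 by simp
      then show ?thesis using e p by (smt (verit) divide_nonneg_pos)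
    next
      case False
      then have "?r powr ?s n \<le> ?r powr (-1)" using s r p by (intro powr_mono') auto
      also have "\<dots> = 1 / ?r" using r p by (simp add: powr_minus_divide)
      also have "\<dots> \<le> 1 / p" using r p by (intro divide_left_mono mult_pos_pos) auto
      finally show ?thesis using e by linarith
    qed
  qed
  show "AE k in lborel. norm (Complex p k powr of_real (?s n) * stable_exp \<alpha> c (Complex p k))
      \<le> (1 + 1 / p) * norm (stable_exp \<alpha> c (Complex p k))"
    unfolding norm_mult by (intro AE_I2 mult_right_mono bnd) auto
qed (intro borel_measurable_integrable integrable_powr_stable_exp assms)+

lemma stable_line_integral_continuous:
  assumes "0 < \<alpha>" "0 < c"
  shows "(\<lambda>n. stable_line_integral \<alpha> c (-1 + 1 / (real n + 2))) \<longlonglongrightarrow> stable_line_integral \<alpha> c (-1)"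
proof -
  have lim: "(\<lambda>n. 1 / (real n + 2)) \<longlonglongrightarrow> 0"
    using LIMSEQ_ignore_initial_segment[OF lim_1_over_n, of 2] by (simp add: add.commute)
  have "(\<lambda>n. 2 * pi * (c powr (- (1 / (real n + 2) / \<alpha>)) * rGamma (1 - 1 / (real n + 2) / \<alpha>) / \<alpha>))
    \<longlonglongrightarrow> 2 * pi * (c powr (- (0 / \<alpha>)) * rGamma (1 - 0 / \<alpha>) / \<alpha>)"
    using assms by (intro tendsto_intros isCont_tendsto_compose[OF isCont_rGamma[OF continuous_ident]] lim) auto
  then show ?thesis by (simp add: stable_line_integral_def)
qed

text \<open>A Hankel-type representation of \<open>1/\<Gamma>\<close>. On the range \<open>s \<ge> 1\<close> the line can be moved to the
  imaginary axis; integration by parts then lowers \<open>s\<close> in steps of \<open>\<alpha>\<close>, except at \<open>s = -1\<close>, which is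
  reached by continuity.\<close>
lemma vertical_integral_powr_stable_exp:
  assumes \<alpha>: "1 < \<alpha>" "\<alpha> \<le> 2" and c: "0 < c" and p: "0 < p"
  shows "(\<integral>k. Complex p k powr of_real s * stable_exp \<alpha> c (Complex p k) \<partial>lborel) = of_real (stable_line_integral \<alpha> c s)"
proof -
  let ?J = "\<lambda>s. \<integral>k. Complex p k powr of_real s * stable_exp \<alpha> c (Complex p k) \<partial>lborel"
  have "?J s = of_real (stable_line_integral \<alpha> c s)" if "1 - real j * \<alpha> \<le> s" for j s
    using that
  proof (induction j arbitrary: s)
    case 0
    then show ?case using vertical_integral_powr_stable_exp_ge_1[OF assms] by simp
  next
    case (Suc j)
    have step: "?J s = of_real (stable_line_integral \<alpha> c s)" if s: "1 - real (Suc j) * \<alpha> \<le> s" "s \<noteq> -1" for s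
    proof -
      have "?J (s + \<alpha>) = of_real (stable_line_integral \<alpha> c (s + \<alpha>))"
        using s by (intro Suc.IH) (simp add: algebra_simps)
      then have "of_real (s + 1) * ?J s = of_real (- (c * \<alpha>) * stable_line_integral \<alpha> c (s + \<alpha>))"
        using powr_stable_exp_recurrence[OF assms, of s] by simp
      also have "- (c * \<alpha>) * stable_line_integral \<alpha> c (s + \<alpha>) = (s + 1) * stable_line_integral \<alpha> c s"
        using stable_line_integral_recurrence[of \<alpha> c s] \<alpha> c by simp
      also have "of_real ((s + 1) * stable_line_integral \<alpha> c s) = of_real (s + 1) * complex_of_real (stable_line_integral \<alpha> c s)"
        by (rule of_real_mult)
      finally have "of_real (s + 1) * ?J s = of_real (s + 1) * of_real (stable_line_integral \<alpha> c s)" .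
      moreover have "complex_of_real (s + 1) \<noteq> 0"
        unfolding of_real_eq_0_iff using s(2) by linarith
      ultimately show ?thesis unfolding mult_cancel_left by blast
    qed
    show ?case
    proof (cases "s = -1")
      case True
      \<comment> \<open>Approaching -1 from above keeps the exponents in the range of this induction
        step and off the exceptional value, so that \<open>step\<close> applies to each of
        them.\<close>
      let ?s = "\<lambda>n. -1 + 1 / (real n + 2)"
      have "?J (?s n) = of_real (stable_line_integral \<alpha> c (?s n))" for n
      proof (rule step)
        have "s \<le> ?s n" using True by simp
        then show "1 - real (Suc j) * \<alpha> \<le> ?s n" using Suc.prems by linarith
      qed auto
      then have "(\<lambda>n. of_real (stable_line_integral \<alpha> c (?s n))) \<longlonglongrightarrow> ?J (-1)"
        using vertical_integral_powr_stable_exp_continuous[OF assms] by simp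
      moreover have "(\<lambda>n. complex_of_real (stable_line_integral \<alpha> c (?s n))) \<longlonglongrightarrow> of_real (stable_line_integral \<alpha> c (-1))"
        using stable_line_integral_continuous[of \<alpha> c] \<alpha> c by (intro tendsto_of_real) auto
      ultimately show ?thesis unfolding True by (rule LIMSEQ_unique)
    qed (use step Suc.prems in blast)
  qed
  moreover obtain j where "1 - s < real j * \<alpha>" using reals_Archimedean3[of \<alpha>] \<alpha> by auto
  ultimately show ?thesis by (metis add.commute diff_less_eq less_imp_le)
qed

section \<open>Densities from integrable characteristic functions\<close>

lemma emeasure_lborel_Ioc_finite: "emeasure lborel {a<..b::real} < top"
  by (cases "a \<le> b") auto

context real_distribution
begin

text \<open>The Fourier inversion integral, kept complex valued; its real part will serve as the
  density.\<close>

definition inverse_char :: "real \<Rightarrow> complex" where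
  "inverse_char x = (\<integral>t. iexp (- (t * x)) * char M t \<partial>lborel) / (2 * pi)"

context
  assumes int_char: "integrable lborel (char M)"
begin

lemma char_measurable_lborel [measurable]: "char M \<in> borel_measurable borel"
  using int_char by (auto dest: borel_measurable_integrable)

lemma norm_inverse_char_le: "norm (inverse_char x) \<le> (\<integral>t. norm (char M t) \<partial>lborel) / (2 * pi)"
proof -
  have "norm (\<integral>t. iexp (- (t * x)) * char M t \<partial>lborel) \<le> (\<integral>t. norm (iexp (- (t * x)) * char M t) \<partial>lborel)"
    by (rule integral_norm_bound)
  also have "\<dots> = (\<integral>t. norm (char M t) \<partial>lborel)" by (simp add: norm_mult)
  finally show ?thesis by (simp add: inverse_char_def norm_divide divide_right_mono)
qed

lemma isCont_inverse_char: "isCont inverse_char x"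
proof (rule continuous_at_sequentiallyI)
  fix u :: "nat \<Rightarrow> real" assume u: "u \<longlonglongrightarrow> x"
  have "(\<lambda>n. \<integral>t. iexp (- (t * u n)) * char M t \<partial>lborel) \<longlonglongrightarrow> (\<integral>t. iexp (- (t * x)) * char M t \<partial>lborel)"
  proof (rule integral_dominated_convergence[where w = "\<lambda>t. norm (char M t)"])
    show "AE t in lborel. (\<lambda>n. iexp (- (t * u n)) * char M t) \<longlonglongrightarrow> iexp (- (t * x)) * char M t"
      by (intro AE_I2 tendsto_intros u)
  qed (use int_char in \<open>auto simp: norm_mult\<close>)
  then show "(\<lambda>n. inverse_char (u n)) \<longlonglongrightarrow> inverse_char x"
    unfolding inverse_char_def by (intro tendsto_divide tendsto_const) auto
qed

lemma integrable_indicator_iexp_char: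
  "integrable (lborel \<Otimes>\<^sub>M lborel) (\<lambda>(x, t). indicator {a<..b} x *\<^sub>R (iexp (- (t * x)) * char M t))"
proof (rule Bochner_Integration.integrable_bound)
  show "integrable (lborel \<Otimes>\<^sub>M lborel) (\<lambda>(x, t). (indicator {a<..b} x :: real) * norm (char M t))"
    by (rule integrable_mult_pair[OF _ integrable_norm[OF int_char]])
       (simp add: integrable_indicator_iff emeasure_lborel_Ioc_finite)
qed (auto simp: norm_mult indicator_def)

lemma integrable_indicator_inverse_char: "integrable lborel (\<lambda>x. indicator {a<..b} x *\<^sub>R inverse_char x)"
  and integral_indicator_inverse_char:
    "(\<integral>x. indicator {a<..b} x *\<^sub>R inverse_char x \<partial>lborel)
     = (\<integral>t. (\<integral>x. indicator {a<..b} x *\<^sub>R (iexp (- (t * x)) * char M t) \<partial>lborel) \<partial>lborel) / (2 * pi)"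
proof -
  have e: "indicator {a<..b} x *\<^sub>R inverse_char x
      = (\<integral>t. indicator {a<..b} x *\<^sub>R (iexp (- (t * x)) * char M t) \<partial>lborel) / (2 * pi)" for x
    unfolding inverse_char_def by (simp add: indicator_def)
  show "integrable lborel (\<lambda>x. indicator {a<..b} x *\<^sub>R inverse_char x)"
    unfolding e by (intro integrable_divide lborel_pair.integrable_fst[OF integrable_indicator_iexp_char])
  show "(\<integral>x. indicator {a<..b} x *\<^sub>R inverse_char x \<partial>lborel)
     = (\<integral>t. (\<integral>x. indicator {a<..b} x *\<^sub>R (iexp (- (t * x)) * char M t) \<partial>lborel) \<partial>lborel) / (2 * pi)"
    unfolding e integral_divide_zero
    by (simp only: lborel_pair.Fubini_integral[OF integrable_indicator_iexp_char, symmetric])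
qed

lemma integral_iexp_Ioc:
  assumes "a \<le> b" "t \<noteq> 0"
  shows "(\<integral>x. indicator {a<..b} x *\<^sub>R iexp (- (t * x)) \<partial>lborel)
    = (iexp (- (t * a)) - iexp (- (t * b))) / (\<i> * t)"
proof -
  have "(LBINT x=a..b. iexp (- (t * x))) = - iexp (- (t * b)) / (\<i> * t) - (- iexp (- (t * a)) / (\<i> * t))"
  proof (rule interval_integral_FTC_finite)
    show "continuous_on {min a b..max a b} (\<lambda>x. iexp (- (t * x)))"
      by (intro continuous_intros)
    fix x
    have "((\<lambda>z. - exp (- (\<i> * (of_real t * z))) / (\<i> * of_real t)) has_field_derivative
        exp (- (\<i> * (of_real t * of_real x)))) (at (complex_of_real x))"
      using assms(2) by (auto intro!: derivative_eq_intros simp: field_simps)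
    from field_vector_diff_chain_at[OF has_vector_derivative_of_real[OF DERIV_ident] this]
    have "((\<lambda>x. - iexp (- (t * x)) / (\<i> * t)) has_vector_derivative iexp (- (t * x))) (at x)"
      by (simp add: o_def)
    then show "((\<lambda>x. - iexp (- (t * x)) / (\<i> * t)) has_vector_derivative iexp (- (t * x)))
        (at x within {min a b..max a b})"
      by (rule has_vector_derivative_at_within)
  qed
  then show ?thesis
    using assms by (simp add: interval_integral_Ioc set_lebesgue_integral_def diff_divide_distrib)
qed

text \<open>Levy's inversion formula gives a limit of truncated integrals. Integrability of the
  characteristic function turns the limit into a full integral, and Fubini turns that into an
  integral of \<open>inverse_char\<close>.\<close>

lemma measure_Ioc_non_atoms:
  assumes ab: "a \<le> b" and "measure M {a} = 0" "measure M {b} = 0"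
  shows "of_real (measure M {a<..b}) = (\<integral>x. indicator {a<..b} x *\<^sub>R inverse_char x \<partial>lborel)"
proof -
  let ?F = "\<lambda>t. (iexp (- (t * a)) - iexp (- (t * b))) / (\<i> * t)"
  \<comment> \<open>Off t = 0, \<open>K\<close> is Levy's kernel times the characteristic function.
    Written as an x-integral it is integrable by Fubini, so its norm can dominate all
    truncations.\<close>
  define K where "K t = (\<integral>x. indicator {a<..b} x *\<^sub>R (iexp (- (t * x)) * char M t) \<partial>lborel)" for t
  have intK: "integrable lborel K"
    unfolding K_def by (rule lborel_pair.integrable_snd[OF integrable_indicator_iexp_char])
  then have [measurable]: "K \<in> borel_measurable borel" by (auto dest: borel_measurable_integrable)
  have K: "K t = ?F t * char M t" if "t \<noteq> 0" for t
    unfolding K_def integral_iexp_Ioc[OF ab that, symmetric]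
    by (subst integral_mult_left_zero[symmetric]) (simp add: scaleR_conv_of_real mult.assoc)
  have "(\<lambda>T::nat. \<integral>t. indicator {- real T<..<real T} t *\<^sub>R (?F t * char M t) \<partial>lborel) \<longlonglongrightarrow> (\<integral>t. K t \<partial>lborel)"
  proof (rule integral_dominated_convergence[where w = "\<lambda>t. norm (K t)"])
    show "integrable lborel (\<lambda>t. norm (K t))" using intK by (rule integrable_norm)
    show "AE t in lborel. norm (indicator {- real T<..<real T} t *\<^sub>R (?F t * char M t)) \<le> norm (K t)" for T :: nat
      using AE_lborel_singleton[of 0] by eventually_elim (simp add: K indicator_def)
    show "AE t in lborel. (\<lambda>T::nat. indicator {- real T<..<real T} t *\<^sub>R (?F t * char M t)) \<longlonglongrightarrow> K t"
      using AE_lborel_singleton[of 0]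
    proof eventually_elim
      fix t :: real assume t: "t \<noteq> 0"
      obtain N :: nat where "\<bar>t\<bar> < real N" using reals_Archimedean2 by blast
      then have "eventually (\<lambda>T::nat. indicator {- real T<..<real T} t *\<^sub>R (?F t * char M t) = K t) sequentially"
        unfolding K[OF t] by (intro eventually_sequentiallyI[of N]) (auto simp: indicator_def)
      then show "(\<lambda>T::nat. indicator {- real T<..<real T} t *\<^sub>R (?F t * char M t)) \<longlonglongrightarrow> K t"
        by (rule tendsto_eventually)
    qed
  qed simp_all
  moreover have "(CLBINT t=-real T..real T. ?F t * char M t)
      = (\<integral>t. indicator {- real T<..<real T} t *\<^sub>R (?F t * char M t) \<partial>lborel)" for T :: nat
    by (simp add: interval_lebesgue_integral_def set_lebesgue_integral_def)
  ultimately have "(\<lambda>T::nat. 1 / (2 * pi) * (CLBINT t=-real T..real T. ?F t * char M t))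
      \<longlonglongrightarrow> 1 / (2 * pi) * (\<integral>t. K t \<partial>lborel)"
    by (intro tendsto_mult tendsto_const) simp
  moreover have "(\<lambda>T::nat. 1 / (2 * pi) * (CLBINT t=-real T..real T. ?F t * char M t))
      \<longlonglongrightarrow> of_real (measure M {a<..b})"
    using Levy_Inversion[OF assms] by simp
  ultimately have "of_real (measure M {a<..b}) = 1 / (2 * pi) * (\<integral>t. K t \<partial>lborel)"
    by (rule LIMSEQ_unique[rotated])
  then show ?thesis unfolding integral_indicator_inverse_char K_def by simp
qed

lemma measure_Ioc_non_atoms_le:
  assumes "a \<le> b" "measure M {a} = 0" "measure M {b} = 0"
  shows "measure M {a<..b} \<le> (b - a) * ((\<integral>t. norm (char M t) \<partial>lborel) / (2 * pi))"
proof -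
  let ?G = "(\<integral>t. norm (char M t) \<partial>lborel) / (2 * pi)"
  have i: "integrable lborel (\<lambda>x. indicator {a<..b} x * ?G)"
    by (intro integrable_mult_left) (simp add: integrable_indicator_iff emeasure_lborel_Ioc_finite)
  have "measure M {a<..b} = norm (\<integral>x. indicator {a<..b} x *\<^sub>R inverse_char x \<partial>lborel)"
    unfolding measure_Ioc_non_atoms[OF assms, symmetric] by simp
  also have "\<dots> \<le> (\<integral>x. indicator {a<..b} x * ?G \<partial>lborel)"
    by (rule order_trans[OF integral_norm_bound integral_mono[OF integrable_norm[OF integrable_indicator_inverse_char] i]])
       (use mult_left_mono[OF norm_inverse_char_le, of "indicator {a<..b} x :: real" for x] in auto)
  also have "\<dots> = (b - a) * ?G" using assms(1) by simp
  finally show ?thesis .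
qed

text \<open>Levy's formula excludes endpoints that carry mass. Such points are countably many, so
  any point lies in arbitrarily short intervals with admissible endpoints, and the mass of these is
  at most proportional to their length.\<close>

lemma no_atoms: "measure M {x} = 0"
proof (rule ccontr)
  assume "measure M {x} \<noteq> 0"
  then have x: "0 < measure M {x}" using measure_nonneg[of M "{x}"] by linarith
  define G where "G = (\<integral>t. norm (char M t) \<partial>lborel) / (2 * pi)"
  have G: "0 \<le> G" by (simp add: G_def)
  \<comment> \<open>The interval found below is shorter than 2 d, so its mass is at most the
    fraction G / (G + 1) < 1 of the supposed atom; adding 1 covers G = 0.\<close>
  define d where "d = measure M {x} / (2 * (G + 1))"
  have d: "0 < d" using x G by (simp add: d_def)
  obtain a where a: "x - d < a" "a < x" "measure M {a} = 0"
    using open_minus_countable[OF countable_support, of "{x - d<..<x}"] d by auto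
  obtain b where b: "x < b" "b < x + d" "measure M {b} = 0"
    using open_minus_countable[OF countable_support, of "{x<..<x + d}"] d by auto
  have "measure M {x} \<le> measure M {a<..b}"
    using a b by (intro finite_measure_mono) auto
  also have "\<dots> \<le> (b - a) * G"
    unfolding G_def using a b by (intro measure_Ioc_non_atoms_le) auto
  also have "\<dots> \<le> 2 * d * G" using a b G by (intro mult_right_mono) auto
  also have "\<dots> = measure M {x} * (G / (G + 1))" using G by (simp add: d_def field_simps)
  also have "\<dots> < measure M {x} * 1" using x G by (intro mult_strict_left_mono) auto
  finally show False by simp
qed

lemma measure_Ioc:
  assumes "a \<le> b"
  shows "integrable lborel (\<lambda>x. indicator {a<..b} x * Re (inverse_char x))"
    and "measure M {a<..b} = (\<integral>x. indicator {a<..b} x * Re (inverse_char x) \<partial>lborel)"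
proof -
  have e: "indicator {a<..b} x * Re (inverse_char x) = Re (indicator {a<..b} x *\<^sub>R inverse_char x)" for x
    by simp
  show "integrable lborel (\<lambda>x. indicator {a<..b} x * Re (inverse_char x))"
    unfolding e by (rule integrable_Re[OF integrable_indicator_inverse_char])
  show "measure M {a<..b} = (\<integral>x. indicator {a<..b} x * Re (inverse_char x) \<partial>lborel)"
    unfolding e integral_Re[OF integrable_indicator_inverse_char]
      measure_Ioc_non_atoms[OF assms no_atoms no_atoms, symmetric] by simp
qed

text \<open>A negative value would persist on a short interval by continuity and give that interval
  negative probability.\<close>

lemma Re_inverse_char_nonneg: "0 \<le> Re (inverse_char x)"
proof (rule ccontr)
  assume "\<not> 0 \<le> Re (inverse_char x)"
  then have neg: "Re (inverse_char x) < 0" by simp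
  have "isCont (\<lambda>y. Re (inverse_char y)) x" by (intro continuous_Re isCont_inverse_char)
  then have "((\<lambda>y. Re (inverse_char y)) \<longlongrightarrow> Re (inverse_char x)) (nhds x)"
    using tendsto_at_iff_tendsto_nhds[of "\<lambda>y. Re (inverse_char y)" x] by (simp add: isCont_def)
  from order_tendstoD(2)[OF this, of "Re (inverse_char x) / 2"]
  have "eventually (\<lambda>y. Re (inverse_char y) < Re (inverse_char x) / 2) (nhds x)"
    using neg by simp
  then obtain d where d: "0 < d" "\<And>y. dist y x < d \<Longrightarrow> Re (inverse_char y) < Re (inverse_char x) / 2"
    unfolding eventually_nhds_metric by blast
  have "0 \<le> measure M {x<..x + d / 2}" by simp
  also have "\<dots> = (\<integral>y. indicator {x<..x + d / 2} y * Re (inverse_char y) \<partial>lborel)"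
    using d by (intro measure_Ioc) auto
  also have "\<dots> \<le> (\<integral>y. indicator {x<..x + d / 2} y * (Re (inverse_char x) / 2) \<partial>lborel)"
  proof (rule integral_mono)
    show "integrable lborel (\<lambda>y. indicator {x<..x + d / 2} y * Re (inverse_char y))"
      using d by (intro measure_Ioc) auto
    show "integrable lborel (\<lambda>y. indicator {x<..x + d / 2} y * (Re (inverse_char x) / 2))"
      by (intro integrable_mult_left) (simp add: integrable_indicator_iff emeasure_lborel_Ioc_finite)
    show "indicator {x<..x + d / 2} y * Re (inverse_char y)
        \<le> indicator {x<..x + d / 2} y * (Re (inverse_char x) / 2)" for y
      using d(1) d(2)[of y] by (auto simp: indicator_def dist_real_def)
  qed
  also have "\<dots> = d / 2 * (Re (inverse_char x) / 2)" using d by simp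
  also have "\<dots> < 0" using d neg by (simp add: mult_pos_neg)
  finally show False by simp
qed

lemma distribution_eq_density: "M = density lborel (\<lambda>x. ennreal (Re (inverse_char x)))"
proof (rule measure_eqI_generator_eq[where \<Omega> = UNIV and E = "range (\<lambda>(a, b). {a<..b})"
      and A = "\<lambda>n::nat. {- real n<..real n}"])
  have cont: "continuous_on UNIV (\<lambda>x. Re (inverse_char x))"
    by (intro continuous_at_imp_continuous_on ballI continuous_Re isCont_inverse_char)
  then have [measurable]: "(\<lambda>x. Re (inverse_char x)) \<in> borel_measurable borel"
    by (rule borel_measurable_continuous_onI)
  show "Int_stable (range (\<lambda>(a, b). {a<..b::real}))"
    by (auto simp: Int_stable_def)
  show "sets M = sigma_sets UNIV (range (\<lambda>(a, b). {a<..b::real}))"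
    unfolding events_eq_borel by (subst borel_sigma_sets_Ioc) simp
  then show "sets (density lborel (\<lambda>x. ennreal (Re (inverse_char x)))) = sigma_sets UNIV (range (\<lambda>(a, b). {a<..b::real}))"
    by simp
  show "(\<Union>n. {- real n<..real n}) = UNIV"
  proof (intro equalityI subsetI UNIV_I)
    fix x :: real
    obtain n :: nat where "\<bar>x\<bar> < real n" using reals_Archimedean2 by blast
    then show "x \<in> (\<Union>n. {- real n<..real n})" by (auto intro!: exI[of _ n])
  qed
  show "emeasure M X = emeasure (density lborel (\<lambda>x. ennreal (Re (inverse_char x)))) X"
    if hX: "X \<in> range (\<lambda>(a, b). {a<..b})" for X
  proof -
    obtain a b where X: "X = {a<..b}" using hX by auto
    show ?thesis
    proof (cases "a \<le> b")
      case True
      have "emeasure (density lborel (\<lambda>x. ennreal (Re (inverse_char x)))) X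
          = (\<integral>\<^sup>+x. ennreal (indicator {a<..b} x * Re (inverse_char x)) \<partial>lborel)"
        unfolding X by (subst emeasure_density) (auto intro!: nn_integral_cong simp: indicator_def)
      also have "\<dots> = ennreal (measure M X)"
        unfolding X measure_Ioc(2)[OF True] using Re_inverse_char_nonneg
        by (intro nn_integral_eq_integral measure_Ioc(1)[OF True]) auto
      finally show ?thesis by (simp add: emeasure_eq_measure)
    qed (simp add: X)
  qed
qed (auto simp: emeasure_eq_measure)

lemma integral_eq_inverse_char:
  fixes f :: "real \<Rightarrow> real"
  assumes f [measurable]: "f \<in> borel_measurable borel"
    and int: "integrable lborel (\<lambda>x. f x * Re (inverse_char x))"
  shows "integrable M f" "(\<integral>x. f x \<partial>M) = (\<integral>x. f x * Re (inverse_char x) \<partial>lborel)"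
proof -
  have [measurable]: "(\<lambda>x. Re (inverse_char x)) \<in> borel_measurable borel"
    by (intro borel_measurable_continuous_onI continuous_at_imp_continuous_on ballI continuous_Re
        isCont_inverse_char)
  have int': "integrable lborel (\<lambda>x. Re (inverse_char x) * f x)" using int by (simp add: mult.commute)
  show "integrable M f"
    by (subst distribution_eq_density, subst integrable_density)
       (use int' Re_inverse_char_nonneg in auto)
  show "(\<integral>x. f x \<partial>M) = (\<integral>x. f x * Re (inverse_char x) \<partial>lborel)"
    by (subst distribution_eq_density, subst integral_density)
       (use Re_inverse_char_nonneg in \<open>auto simp: mult.commute\<close>)
qed

end

end

section \<open>Series expansions\<close>

lemma has_bochner_integral_exp_Ioi:
  fixes w :: complex
  assumes w: "0 < Re w"
  shows "has_bochner_integral lborel (\<lambda>x. indicator {a<..} x *\<^sub>R exp (- w * of_real x)) (exp (- w * of_real a) / w)"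
proof -
  let ?d = "Re w"
  have "integrable lborel (\<lambda>x. indicator {0<..} x *\<^sub>R exp (- (x * ?d)))"
    using integrable_I0i_exp_mscale[OF w] by (simp add: set_integrable_def)
  from lborel_integrable_real_affine[OF this, of 1 "-a"]
  have "integrable lborel (\<lambda>x. indicator {0<..} (- a + 1 * x) *\<^sub>R exp (- ((- a + 1 * x) * ?d)))" by simp
  then have i: "integrable lborel (\<lambda>x. indicator {a<..} x *\<^sub>R exp (- w * of_real x))"
  proof (rule Bochner_Integration.integrable_bound[OF integrable_mult_right[of "exp (- (a * ?d))"]])
    show "AE x in lborel. norm (indicator {a<..} x *\<^sub>R exp (- w * of_real x))
      \<le> norm (exp (- (a * ?d)) * (indicator {0<..} (- a + 1 * x) *\<^sub>R exp (- ((- a + 1 * x) * ?d))))"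
      by (auto simp: indicator_def exp_add[symmetric] algebra_simps)
  qed simp
  have w0: "w \<noteq> 0" using w by auto
  have "(LBINT x=a..\<infinity>. exp (- w * of_real x)) = 0 - (- exp (- w * of_real a) / w)"
  proof (rule interval_integral_FTC_integrable[where F = "\<lambda>x. - exp (- w * of_real x) / w"])
    fix x :: real
    have "((\<lambda>z. - exp (- w * z) / w) has_field_derivative exp (- w * of_real x)) (at (of_real x))"
      using w0 by (auto intro!: derivative_eq_intros simp: field_simps)
    from field_vector_diff_chain_at[OF has_vector_derivative_of_real[OF DERIV_ident] this]
    show "((\<lambda>x. - exp (- w * of_real x) / w) has_vector_derivative exp (- w * of_real x)) (at x)"
      by (simp add: o_def)
    show "isCont (\<lambda>x. exp (- w * of_real x)) x" by (intro continuous_intros)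
  next
    show "set_integrable lborel (einterval (ereal a) \<infinity>) (\<lambda>x. exp (- w * of_real x))"
      using i by (simp add: set_integrable_def)
    have "((\<lambda>x. - exp (- w * of_real x) / w) \<longlongrightarrow> - exp (- w * of_real a) / w) (at_right a)"
      using w0 by (intro tendsto_intros)
    then show "(((\<lambda>x. - exp (- w * of_real x) / w) \<circ> real_of_ereal) \<longlongrightarrow> - exp (- w * of_real a) / w) (at_right (ereal a))"
      by (simp add: ereal_tendsto_simps)
    have "LIM x at_top. ?d * x :> at_top"
      by (rule filterlim_tendsto_pos_mult_at_top[OF tendsto_const w filterlim_ident])
    then have "LIM x at_top. - (?d * x) :> at_bot"
      by (rule filterlim_compose[OF filterlim_uminus_at_bot_at_top])
    then have "((\<lambda>x. exp (- (?d * x))) \<longlongrightarrow> 0) at_top"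
      by (rule filterlim_compose[OF exp_at_bot])
    then have "((\<lambda>x. exp (- (?d * x)) / norm w) \<longlongrightarrow> 0) at_top"
      by (rule tendsto_divide_zero)
    then have "((\<lambda>x. - exp (- w * of_real x) / w) \<longlongrightarrow> 0) at_top"
      by (rule Lim_null_comparison[rotated]) (simp add: norm_divide norm_exp_eq_Re)
    then show "(((\<lambda>x. - exp (- w * of_real x) / w) \<circ> real_of_ereal) \<longlongrightarrow> 0) (at_left \<infinity>)"
      by (simp add: ereal_tendsto_simps)
  qed simp
  then show ?thesis
    using i by (simp add: has_bochner_integral_iff interval_lebesgue_integral_def set_lebesgue_integral_def)
qed

text \<open>Both expansions under the integral have a majorant of this product form: ratio u / p for
  the geometric series, ratio 1 / 2 for the exponential series.\<close>

lemma dominated_sums: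
  fixes f :: "nat \<Rightarrow> 'a \<Rightarrow> complex"
  assumes meas: "\<And>n. f n \<in> borel_measurable M"
    and bound: "\<And>n x. norm (f n x) \<le> r ^ n * w x"
    and w: "integrable M w" and r: "0 \<le> r" "r < (1::real)"
  shows "(\<lambda>n. \<integral>x. f n x \<partial>M) sums (\<integral>x. (\<Sum>n. f n x) \<partial>M)"
proof (rule sums_integral)
  show i: "integrable M (f n)" for n
    by (rule Bochner_Integration.integrable_bound[OF integrable_mult_right[OF w, of "r ^ n"] meas])
       (use bound in \<open>auto intro: order_trans[OF _ abs_ge_self]\<close>)
  show "AE x in M. summable (\<lambda>n. norm (f n x))"
    by (intro AE_I2 summable_comparison_test'[OF summable_mult2[OF summable_geometric[of r]]])
       (use bound r in auto)
  have "norm (\<integral>x. norm (f n x) \<partial>M) \<le> r ^ n * (\<integral>x. w x \<partial>M)" for n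
  proof -
    have "(\<integral>x. norm (f n x) \<partial>M) \<le> (\<integral>x. r ^ n * w x \<partial>M)"
      by (intro integral_mono integrable_norm i integrable_mult_right w bound)
    then show ?thesis by simp
  qed
  then show "summable (\<lambda>n. \<integral>x. norm (f n x) \<partial>M)"
    by (intro summable_comparison_test'[OF summable_mult2[OF summable_geometric[of r]]]) (use r in auto)
qed

text \<open>(2 a)^n / n! is a single term of the series of exp (2 a). Doubling the exponent buys the
  geometric factor that \<open>dominated_sums\<close> asks for.\<close>

lemma power_div_fact_le:
  fixes a :: real
  assumes "0 \<le> a"
  shows "a ^ n / fact n \<le> (1 / 2) ^ n * exp (2 * a)"
proof -
  have "(2 * a) ^ n /\<^sub>R fact n \<le> exp (2 * a)"
    using sums_le[OF _ sums_single[of n "\<lambda>m. (2 * a) ^ m /\<^sub>R fact m"] exp_converges[of "2 * a"]] assms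
    by (simp add: inverse_eq_divide)
  then show ?thesis by (simp add: power_mult_distrib field_simps power_one_over)
qed

lemma stable_exp_bound:
  assumes \<alpha>: "1 < \<alpha>" "\<alpha> \<le> 2" and c: "0 < c" and B: "0 \<le> B" and p: "0 \<le> p"
  shows "\<exists>C. \<forall>k. exp (B * norm (Complex p k)) * norm (stable_exp \<alpha> c (Complex p k)) \<le> C * exp (- \<bar>k\<bar>)"
  using exp_powr_bound[OF \<alpha> c B, of p] p unfolding stable_exp_def by blast

definition gap_coeff :: "real \<Rightarrow> real \<Rightarrow> real \<Rightarrow> real \<Rightarrow> nat \<Rightarrow> nat \<Rightarrow> real" where
  "gap_coeff \<alpha> c u y n m = u ^ m * y ^ n * c powr ((real m - real n) / \<alpha>) / fact n * rGamma (1 + (real m - real n) / \<alpha>)"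

lemma continuous_vertical_stable_exp:
  assumes "0 < p" "0 < \<alpha>"
  shows "continuous_on UNIV (\<lambda>k. stable_exp \<alpha> c (Complex p k))"
  by (rule continuous_on_vertical[OF continuous_on_stable_exp_open]) (use assms in auto)

text \<open>Geometric series 1 / (q - u) = sum of u^m / q^(m + 1), with |u / q| \<le> u / p < 1 on
  the whole line. Each term is a Hankel integral with s = n - m - 1, so s + 1 = n - m, and 1 - (s +
  1) / \<alpha> is the argument of \<open>rGamma\<close> in the series.\<close>

lemma gap_coeff_sums:
  assumes \<alpha>: "1 < \<alpha>" "\<alpha> \<le> 2" and c: "0 < c" and u: "0 \<le> u" and p: "u < p"
  shows "(\<lambda>m. of_real (gap_coeff \<alpha> c u y n m)) sums
    (of_real (\<alpha> / (2 * pi)) * (\<integral>k. (Complex p k * of_real y) ^ n / fact n / (Complex p k - of_real u) * stable_exp \<alpha> c (Complex p k) \<partial>lborel))"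
proof -
  have p0: "0 < p" using u p by simp
  have q0: "Complex p k \<noteq> 0" for k using p0 by (auto simp: complex_eq_iff)
  have qp: "p \<le> norm (Complex p k)" for k using abs_Re_le_cmod[of "Complex p k"] by simp
  let ?f = "\<lambda>m k. of_real (y ^ n / fact n * u ^ m) * (Complex p k powr of_real (real n - real m - 1) * stable_exp \<alpha> c (Complex p k))"
  let ?B = "\<lambda>k. norm (of_real (y ^ n / fact n) * (Complex p k powr of_real (real n) * stable_exp \<alpha> c (Complex p k))) / p"
  have pw: "Complex p k powr of_real (real n - real m - 1) = Complex p k powr of_real (real n) * (1 / Complex p k) ^ m / Complex p k" for m k
  proof -
    have "Complex p k powr of_real (real n - real m - 1) = Complex p k powr (of_real (real n) - of_nat (Suc m))"
      by (simp add: algebra_simps)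
    also have "\<dots> = Complex p k powr of_real (real n) / Complex p k powr of_nat (Suc m)"
      by (rule powr_diff)
    also have "Complex p k powr of_nat (Suc m) = Complex p k ^ Suc m"
      by (rule powr_nat') simp
    finally show ?thesis by (simp add: power_one_over)
  qed
  have "(\<lambda>m. \<integral>k. ?f m k \<partial>lborel) sums (\<integral>k. (\<Sum>m. ?f m k) \<partial>lborel)"
  proof (rule dominated_sums[where r = "u / p" and w = ?B])
    show "integrable lborel ?B"
      by (intro integrable_divide integrable_norm integrable_mult_right integrable_powr_stable_exp \<alpha> c p0)
    show "?f m \<in> borel_measurable lborel" for m
      by (intro borel_measurable_integrable integrable_mult_right integrable_powr_stable_exp \<alpha> c p0)
    show "norm (?f m k) \<le> (u / p) ^ m * ?B k" for m k
    proof -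
      have "norm (?f m k) = norm (of_real (y ^ n / fact n) * (Complex p k powr of_real (real n) * stable_exp \<alpha> c (Complex p k)))
          * ((u / norm (Complex p k)) ^ m / norm (Complex p k))"
        unfolding pw using u by (simp add: norm_mult norm_divide norm_power power_divide)
      also have "\<dots> \<le> norm (of_real (y ^ n / fact n) * (Complex p k powr of_real (real n) * stable_exp \<alpha> c (Complex p k)))
          * ((u / p) ^ m / p)"
        using u p0 qp[of k] by (intro mult_left_mono frac_le power_mono divide_left_mono mult_pos_pos) auto
      finally show ?thesis by (simp add: mult_ac)
    qed
  qed (use u p in auto)
  also have "(\<lambda>m. \<integral>k. ?f m k \<partial>lborel) = (\<lambda>m. of_real (y ^ n / fact n * u ^ m) * of_real (stable_line_integral \<alpha> c (real n - real m - 1)))"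
    by (simp only: integral_mult_right_zero vertical_integral_powr_stable_exp[OF \<alpha> c p0])
  also have "(\<lambda>k. \<Sum>m. ?f m k) = (\<lambda>k. (Complex p k * of_real y) ^ n / fact n / (Complex p k - of_real u) * stable_exp \<alpha> c (Complex p k))"
  proof
    fix k
    let ?q = "Complex p k"
    have "norm (of_real u / ?q) < 1" using u p p0 qp[of k] by (simp add: norm_divide divide_less_eq)
    from sums_mult[OF geometric_sums[OF this], of "of_real (y ^ n / fact n) * (?q ^ n * stable_exp \<alpha> c ?q / ?q)"]
    have "(\<lambda>m. ?f m k) sums (of_real (y ^ n / fact n) * (?q ^ n * stable_exp \<alpha> c ?q / ?q) * (1 / (1 - of_real u / ?q)))"
      unfolding pw using q0[of k] by (simp add: powr_nat' power_divide mult_ac)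
    also have "1 - of_real u / ?q = (?q - of_real u) / ?q" using q0[of k] by (simp add: field_simps)
    also have "of_real (y ^ n / fact n) * (?q ^ n * stable_exp \<alpha> c ?q / ?q) * (1 / ((?q - of_real u) / ?q))
        = (?q * of_real y) ^ n / fact n / (?q - of_real u) * stable_exp \<alpha> c ?q"
      using q0[of k] by (simp add: power_mult_distrib mult_ac)
    finally have "(\<lambda>m. ?f m k) sums ((?q * of_real y) ^ n / fact n / (?q - of_real u) * stable_exp \<alpha> c ?q)" .
    then show "(\<Sum>m. ?f m k) = (?q * of_real y) ^ n / fact n / (?q - of_real u) * stable_exp \<alpha> c ?q"
      by (rule sums_unique[symmetric])
  qed
  finally have "(\<lambda>m. of_real (\<alpha> / (2 * pi)) * (of_real (y ^ n / fact n * u ^ m) * of_real (stable_line_integral \<alpha> c (real n - real m - 1)))) sums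
    (of_real (\<alpha> / (2 * pi)) * (\<integral>k. (Complex p k * of_real y) ^ n / fact n / (Complex p k - of_real u) * stable_exp \<alpha> c (Complex p k) \<partial>lborel))"
    by (rule sums_mult)
  moreover have "of_real (\<alpha> / (2 * pi)) * (of_real (y ^ n / fact n * u ^ m) * of_real (stable_line_integral \<alpha> c (real n - real m - 1)))
      = complex_of_real (gap_coeff \<alpha> c u y n m)" for m
  proof -
    have e: "- ((real n - real m - 1 + 1) / \<alpha>) = (real m - real n) / \<alpha>"
      "1 - (real n - real m - 1 + 1) / \<alpha> = 1 + (real m - real n) / \<alpha>"
      by (simp_all add: minus_divide_left[symmetric] diff_divide_distrib)
    show ?thesis
      unfolding stable_line_integral_def e gap_coeff_def of_real_mult[symmetric] of_real_eq_iff using \<alpha> by simp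
  qed
  ultimately show ?thesis by simp
qed

text \<open>Only exp (q y) is expanded here; 1 / (q - u) has modulus at most 1 / (p - u). The
  majorant exp (2 |y| |q|) of the exponential series is absorbed by the decay of
  \<open>stable_exp\<close>.\<close>

lemma gap_row_sums:
  assumes \<alpha>: "1 < \<alpha>" "\<alpha> \<le> 2" and c: "0 < c" and u: "0 \<le> u" and p: "u < p"
  shows "(\<lambda>n. \<integral>k. (Complex p k * of_real y) ^ n / fact n / (Complex p k - of_real u) * stable_exp \<alpha> c (Complex p k) \<partial>lborel)
    sums (\<integral>k. exp (Complex p k * of_real y) / (Complex p k - of_real u) * stable_exp \<alpha> c (Complex p k) \<partial>lborel)"
proof -
  let ?f = "\<lambda>n k. (Complex p k * of_real y) ^ n / fact n / (Complex p k - of_real u) * stable_exp \<alpha> c (Complex p k)"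
  have p0: "0 < p" using u p by simp
  have qu: "p - u \<le> norm (Complex p k - of_real u)" for k
    using abs_Re_le_cmod[of "Complex p k - of_real u"] by simp
  have qu0: "Complex p k - of_real u \<noteq> 0" for k using p by (auto simp: complex_eq_iff)
  obtain C where C: "\<And>k. exp (2 * \<bar>y\<bar> * norm (Complex p k)) * norm (stable_exp \<alpha> c (Complex p k)) \<le> C * exp (- \<bar>k\<bar>)"
    using stable_exp_bound[OF \<alpha> c, of "2 * \<bar>y\<bar>" p] p0 by auto
  have "(\<lambda>n. \<integral>k. ?f n k \<partial>lborel) sums (\<integral>k. (\<Sum>n. ?f n k) \<partial>lborel)"
  proof (rule dominated_sums[where r = "1 / 2" and w = "\<lambda>k. C / (p - u) * exp (- \<bar>k\<bar>)"])
    show "integrable lborel (\<lambda>k. C / (p - u) * exp (- \<bar>k\<bar>))"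
      by (rule integrable_mult_right[OF integrable_exp_neg_abs])
    have "continuous_on UNIV (?f n)" for n
      using qu0 p0 \<alpha> by (intro continuous_intros continuous_vertical_stable_exp) auto
    then show "?f n \<in> borel_measurable lborel" for n
      by (simp add: borel_measurable_continuous_onI)
    show "norm (?f n k) \<le> (1 / 2) ^ n * (C / (p - u) * exp (- \<bar>k\<bar>))" for n k
    proof -
      let ?q = "Complex p k"
      have "norm (?f n k) = (norm ?q * \<bar>y\<bar>) ^ n / fact n * norm (stable_exp \<alpha> c ?q) / norm (?q - of_real u)"
        by (simp add: norm_mult norm_divide norm_power)
      also have "\<dots> \<le> ((1 / 2) ^ n * exp (2 * (norm ?q * \<bar>y\<bar>))) * norm (stable_exp \<alpha> c ?q) / (p - u)"
        using p qu[of k] by (intro frac_le mult_right_mono power_div_fact_le) auto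
      also have "\<dots> = (1 / 2) ^ n / (p - u) * (exp (2 * \<bar>y\<bar> * norm ?q) * norm (stable_exp \<alpha> c ?q))"
        by (simp add: mult_ac)
      also have "\<dots> \<le> (1 / 2) ^ n / (p - u) * (C * exp (- \<bar>k\<bar>))"
        using p by (intro mult_left_mono C) auto
      finally show ?thesis by simp
    qed
  qed auto
  also have "(\<lambda>k. \<Sum>n. ?f n k) = (\<lambda>k. exp (Complex p k * of_real y) / (Complex p k - of_real u) * stable_exp \<alpha> c (Complex p k))"
  proof
    fix k
    let ?q = "Complex p k"
    have "(\<lambda>n. (?q * of_real y) ^ n / fact n) sums exp (?q * of_real y)"
      using exp_converges[of "?q * of_real y"] by (simp add: scaleR_conv_of_real divide_inverse mult.commute)
    then have "(\<lambda>n. ?f n k) sums (exp (?q * of_real y) / (?q - of_real u) * stable_exp \<alpha> c ?q)"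
      by (intro sums_mult2 sums_divide)
    then show "(\<Sum>n. ?f n k) = exp (?q * of_real y) / (?q - of_real u) * stable_exp \<alpha> c ?q"
      by (rule sums_unique[symmetric])
  qed
  finally show ?thesis .
qed

section \<open>Option values\<close>

lemma (in real_distribution) inverse_char_stable:
  assumes \<alpha>: "1 < \<alpha>" "\<alpha> \<le> 2" and c: "0 < c" and p: "0 < p"
    and char: "\<And>k. char M k = stable_exp \<alpha> c (Complex 0 k)"
  shows "integrable lborel (char M)"
    and "inverse_char x = (\<integral>k. exp (- Complex p k * of_real x) * stable_exp \<alpha> c (Complex p k) \<partial>lborel) / (2 * pi)"
proof -
  have I: "integrable lborel (\<lambda>k. exp (- Complex 0 k * of_real x) * stable_exp \<alpha> c (Complex 0 k))
    \<and> (\<integral>k. exp (- Complex p k * of_real x) * stable_exp \<alpha> c (Complex p k) \<partial>lborel)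
      = (\<integral>k. exp (- Complex 0 k * of_real x) * stable_exp \<alpha> c (Complex 0 k) \<partial>lborel)" for x
  proof -
    let ?h = "\<lambda>q::complex. exp (- q * of_real x)" and ?h' = "\<lambda>q::complex. - of_real x * exp (- q * of_real x)"
    have h: "norm (?h q) \<le> exp (\<bar>x\<bar> * norm q)" for q :: complex
    proof -
      have "- (Re q * x) \<le> \<bar>Re q\<bar> * \<bar>x\<bar>" by (metis abs_ge_minus_self abs_mult)
      also have "\<dots> \<le> norm q * \<bar>x\<bar>" by (intro mult_right_mono abs_Re_le_cmod) auto
      finally show ?thesis by (simp add: mult.commute)
    qed
    have 1: "norm (?h q) \<le> (1 + \<bar>x\<bar>) * exp (\<bar>x\<bar> * norm q)" for q :: complex
      using h[of q] by (simp add: distrib_right add_increasing2)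
    have 2: "norm (?h' q) \<le> (1 + \<bar>x\<bar>) * exp (\<bar>x\<bar> * norm q)" for q :: complex
    proof -
      have "norm (?h' q) = \<bar>x\<bar> * norm (?h q)" by (simp only: norm_mult norm_minus_cancel norm_of_real)
      also have "\<dots> \<le> (1 + \<bar>x\<bar>) * exp (\<bar>x\<bar> * norm q)" by (intro mult_mono h) auto
      finally show ?thesis .
    qed
    have d: "(?h has_field_derivative ?h' q) (at q)" for q
      by (auto intro!: derivative_eq_intros)
    have cont: "continuous_on A ?h" for A by (intro continuous_intros)
    have cont': "continuous_on A ?h'" for A by (intro continuous_intros)
    have iso: "isCont ?h q" for q by (intro continuous_intros)
    note L = vertical_integral_stable_exp_eq_boundary[OF \<alpha> c p, of "1 + \<bar>x\<bar>" "\<bar>x\<bar>" ?h ?h']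
    show ?thesis using L[OF _ _ d cont' cont iso 1 2] by simp
  qed
  have e: "iexp (- (k * x)) * char M k = exp (- Complex 0 k * of_real x) * stable_exp \<alpha> c (Complex 0 k)" for k x
    by (simp add: char Complex_eq mult_ac)
  \<comment> \<open>At x = 0 the shifted integrand is the characteristic function itself, so its
    integrability is a special case.\<close>
  have "char M = (\<lambda>k. exp (- Complex 0 k * of_real 0) * stable_exp \<alpha> c (Complex 0 k))"
    by (simp add: char fun_eq_iff)
  with I[of 0] show "integrable lborel (char M)" by (simp only:)
  show "inverse_char x = (\<integral>k. exp (- Complex p k * of_real x) * stable_exp \<alpha> c (Complex p k) \<partial>lborel) / (2 * pi)"
    unfolding inverse_char_def e using I[of x] by simp
qed

text \<open>One double integral over (x, k) read in two orders: k first gives the payoff times the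
  inversion integral, x first gives the kernel 1 / (q - u). At u = 0 the expectation is the
  probability of exceeding - y.\<close>

lemma (in real_distribution) expectation_exp_Ioi_stable:
  assumes \<alpha>: "1 < \<alpha>" "\<alpha> \<le> 2" and c: "0 < c" and u: "0 \<le> u" and p: "u < p"
    and char: "\<And>k. char M k = stable_exp \<alpha> c (Complex 0 k)"
  shows "integrable M (\<lambda>x. indicator {- y<..} x * exp (u * (y + x)))"
    and "(\<integral>x. indicator {- y<..} x * exp (u * (y + x)) \<partial>M)
      = Re ((\<integral>k. exp (Complex p k * of_real y) / (Complex p k - of_real u) * stable_exp \<alpha> c (Complex p k) \<partial>lborel) / (2 * pi))"
proof -
  have p0: "0 < p" using u p by simp
  have w: "0 < Re (Complex p k - of_real u)" for k using p by simp
  let ?E = "\<lambda>k. stable_exp \<alpha> c (Complex p k)"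
  let ?e = "\<lambda>x k. indicator {- y<..} x *\<^sub>R exp (- (Complex p k - of_real u) * of_real x)"
  let ?G = "\<lambda>x k. ?e x k * (of_real (exp (u * y)) * ?E k)"
  have [measurable]: "?E \<in> borel_measurable borel"
    using p0 \<alpha> by (intro borel_measurable_continuous_onI continuous_vertical_stable_exp) auto
  have intE: "integrable lborel ?E"
    using integrable_powr_stable_exp[OF \<alpha> c p0, of 0] p0 by (simp add: complex_eq_iff)
  have "continuous_on UNIV (\<lambda>z::real \<times> real. exp (- (Complex p (snd z) - of_real u) * of_real (fst z)))"
    by (intro continuous_intros)
  then have "(\<lambda>z. exp (- (Complex p (snd z) - of_real u) * of_real (fst z))) \<in> borel_measurable (lborel \<Otimes>\<^sub>M lborel)"
    by (simp add: lborel_prod borel_measurable_continuous_onI)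
  then have [measurable]: "(\<lambda>(x, k). exp (- (Complex p k - of_real u) * of_real x)) \<in> borel_measurable (lborel \<Otimes>\<^sub>M lborel)"
    by (simp add: case_prod_beta)
  have intG: "integrable (lborel \<Otimes>\<^sub>M lborel) (\<lambda>(x, k). ?G x k)"
  proof (rule Bochner_Integration.integrable_bound)
    \<comment> \<open>The modulus of exp (- (q - u) x) depends on Re q = p alone, so its value at k
      = 0 serves for all k and the majorant is a product.\<close>
    have "integrable lborel (\<lambda>x. norm (?e x 0))"
      using has_bochner_integral_exp_Ioi[OF w[of 0]] by (intro integrable_norm) (auto simp: has_bochner_integral_iff)
    moreover have "integrable lborel (\<lambda>k. exp (u * y) * norm (?E k))"
      by (intro integrable_mult_right integrable_norm intE)
    ultimately show "integrable (lborel \<Otimes>\<^sub>M lborel) (\<lambda>(x, k). norm (?e x 0) * (exp (u * y) * norm (?E k)))"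
      by (rule integrable_mult_pair)
    show "(\<lambda>(x, k). ?G x k) \<in> borel_measurable (lborel \<Otimes>\<^sub>M lborel)"
      by measurable
    show "AE z in lborel \<Otimes>\<^sub>M lborel. norm (case z of (x, k) \<Rightarrow> ?G x k)
        \<le> norm (case z of (x, k) \<Rightarrow> norm (?e x 0) * (exp (u * y) * norm (?E k)))"
      by (auto simp: norm_mult)
  qed
  have inner: "(\<integral>x. ?G x k \<partial>lborel) = exp (Complex p k * of_real y) / (Complex p k - of_real u) * ?E k" for k
  proof -
    have "(\<integral>x. ?G x k \<partial>lborel) = exp (- (Complex p k - of_real u) * of_real (- y)) / (Complex p k - of_real u) * (of_real (exp (u * y)) * ?E k)"
      by (simp only: integral_mult_left_zero
          has_bochner_integral_integral_eq[OF has_bochner_integral_exp_Ioi[OF w[of k], of "- y"]])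
    also have "\<dots> = (exp (- (Complex p k - of_real u) * of_real (- y)) * of_real (exp (u * y))) / (Complex p k - of_real u) * ?E k"
      by simp
    also have "exp (- (Complex p k - of_real u) * of_real (- y)) * of_real (exp (u * y)) = exp (Complex p k * of_real y)"
      by (simp add: exp_of_real[symmetric] exp_add[symmetric] algebra_simps)
    finally show ?thesis .
  qed
  let ?f = "\<lambda>x. indicator {- y<..} x * exp (u * (y + x))"
  note char_int = inverse_char_stable(1)[OF \<alpha> c p0 char]
  have outer: "(\<integral>k. ?G x k \<partial>lborel) / (2 * pi) = of_real (?f x) * inverse_char x" for x
  proof -
    have e: "exp (- (Complex p k - of_real u) * of_real x) * of_real (exp (u * y))
        = of_real (exp (u * (y + x))) * exp (- Complex p k * of_real x)" for k
      by (simp add: exp_of_real[symmetric] exp_add[symmetric] algebra_simps)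
    have "?G x k = (indicator {- y<..} x *\<^sub>R (exp (- (Complex p k - of_real u) * of_real x) * of_real (exp (u * y)))) * ?E k" for k
      by simp
    then have "?G x k = of_real (?f x) * (exp (- Complex p k * of_real x) * ?E k)" for k
      unfolding e by (simp add: scaleR_conv_of_real mult.assoc)
    then have "(\<integral>k. ?G x k \<partial>lborel) = of_real (?f x) * (\<integral>k. exp (- Complex p k * of_real x) * ?E k \<partial>lborel)"
      by simp
    then show ?thesis by (simp add: inverse_char_stable(2)[OF \<alpha> c p0 char])
  qed
  have i: "integrable lborel (\<lambda>x. of_real (?f x) * inverse_char x)"
    unfolding outer[symmetric] by (intro integrable_divide lborel_pair.integrable_fst[OF intG])
  then have i': "integrable lborel (\<lambda>x. ?f x * Re (inverse_char x))"
    using integrable_Re[OF i] by simp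
  have m: "?f \<in> borel_measurable borel" by measurable
  show "integrable M ?f" by (rule integral_eq_inverse_char(1)[OF char_int m i'])
  have "(\<integral>x. ?f x \<partial>M) = (\<integral>x. ?f x * Re (inverse_char x) \<partial>lborel)"
    by (rule integral_eq_inverse_char(2)[OF char_int m i'])
  also have "\<dots> = Re (\<integral>x. of_real (?f x) * inverse_char x \<partial>lborel)"
    using integral_Re[OF i] by simp
  also have "(\<integral>x. of_real (?f x) * inverse_char x \<partial>lborel) = (\<integral>k. (\<integral>x. ?G x k \<partial>lborel) \<partial>lborel) / (2 * pi)"
    unfolding outer[symmetric] integral_divide_zero by (simp only: lborel_pair.Fubini_integral[OF intG])
  finally show "(\<integral>x. ?f x \<partial>M)
      = Re ((\<integral>k. exp (Complex p k * of_real y) / (Complex p k - of_real u) * ?E k \<partial>lborel) / (2 * pi))"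
    unfolding inner .
qed

lemma (in real_distribution) expectation_exp_Ioi_stable_series:
  assumes \<alpha>: "1 < \<alpha>" "\<alpha> \<le> 2" and c: "0 < c" and u: "0 \<le> u"
    and char: "\<And>k. char M k = stable_exp \<alpha> c (Complex 0 k)"
  shows "summable (\<lambda>m. gap_coeff \<alpha> c u y n m)"
    and "(\<lambda>n. \<Sum>m. gap_coeff \<alpha> c u y n m) sums (\<alpha> * (\<integral>x. indicator {- y<..} x * exp (u * (y + x)) \<partial>M))"
proof -
  \<comment> \<open>Any p > u would do; the coefficients and the expectation do not depend on the
    line.\<close>
  define p where "p = u + 1"
  have p: "u < p" by (simp add: p_def)
  let ?T = "\<lambda>n. \<integral>k. (Complex p k * of_real y) ^ n / fact n / (Complex p k - of_real u) * stable_exp \<alpha> c (Complex p k) \<partial>lborel"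
  have 1: "(\<lambda>m. gap_coeff \<alpha> c u y n m) sums Re (of_real (\<alpha> / (2 * pi)) * ?T n)" for n
    using sums_Re[OF gap_coeff_sums[OF \<alpha> c u p, where y = y and n = n]] by simp
  then show "summable (\<lambda>m. gap_coeff \<alpha> c u y n m)" by (rule sums_summable)
  have "(\<lambda>n. Re (of_real (\<alpha> / (2 * pi)) * ?T n)) sums
      Re (of_real (\<alpha> / (2 * pi)) * (\<integral>k. exp (Complex p k * of_real y) / (Complex p k - of_real u) * stable_exp \<alpha> c (Complex p k) \<partial>lborel))"
    by (intro sums_Re sums_mult gap_row_sums \<alpha> c u p)
  moreover have "(\<Sum>m. gap_coeff \<alpha> c u y n m) = Re (of_real (\<alpha> / (2 * pi)) * ?T n)" for n
    using 1[of n] by (rule sums_unique[symmetric])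
  ultimately show "(\<lambda>n. \<Sum>m. gap_coeff \<alpha> c u y n m) sums (\<alpha> * (\<integral>x. indicator {- y<..} x * exp (u * (y + x)) \<partial>M))"
    by (simp add: expectation_exp_Ioi_stable(2)[OF \<alpha> c u p char])
qed

text \<open>By 0^0 = 1 only m = 0 survives, which collapses the double series to the cash-or-nothing
  series.\<close>

lemma gap_coeff_u_0: "(\<Sum>m. gap_coeff \<alpha> c 0 y n m) = gap_coeff \<alpha> c 0 y n 0"
proof -
  have "(\<Sum>m. gap_coeff \<alpha> c 0 y n m) = (\<Sum>m\<in>{0}. gap_coeff \<alpha> c 0 y n m)"
    by (rule suminf_finite) (auto simp: gap_coeff_def)
  then show ?thesis by simp
qed

text \<open>(i k)^\<alpha> = |k|^\<alpha> cos (pi \<alpha> / 2) (1 + i tan (pi \<alpha> / 2) sgn k),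
  and the cosine cancels against the one in \<open>stable_mu\<close>.\<close>

lemma stable_char_eq:
  assumes \<alpha>: "1 < \<alpha>" "\<alpha> \<le> 2"
  shows "exp (- (of_real (t * \<sigma> powr \<alpha> * \<bar>k\<bar> powr \<alpha>) * (1 + \<i> * of_real (tan (\<alpha> * pi / 2) * sgn k))))
    = stable_exp \<alpha> (- stable_mu \<alpha> \<sigma> * t) (Complex 0 k)"
proof -
  define C where "C = cos (pi * \<alpha> / 2)"
  have C: "C \<noteq> 0" using cos_half_pi_neg[OF \<alpha>] by (simp add: C_def)
  have tan: "tan (\<alpha> * pi / 2) = sin (pi * \<alpha> / 2) / C" by (simp add: tan_def C_def mult.commute)
  consider "0 < k" | "k = 0" | "0 < - k" by linarith
  then show ?thesis
  proof cases
    case 1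
    have h: "of_real (- stable_mu \<alpha> \<sigma> * t) * Complex 0 k powr of_real \<alpha>
        = - (of_real (t * \<sigma> powr \<alpha> * \<bar>k\<bar> powr \<alpha>) * (1 + \<i> * of_real (tan (\<alpha> * pi / 2) * sgn k)))"
      using 1 C unfolding imaginary_powr[OF 1] tan stable_mu_def C_def[symmetric]
      by (simp add: complex_eq_iff C_def[symmetric])
    show ?thesis by (simp only: stable_exp_def h)
  next
    case 2 then show ?thesis by (simp add: stable_exp_def zero_complex.code[symmetric])
  next
    case 3
    have h: "of_real (- stable_mu \<alpha> \<sigma> * t) * Complex 0 (- (- k)) powr of_real \<alpha>
        = - (of_real (t * \<sigma> powr \<alpha> * \<bar>k\<bar> powr \<alpha>) * (1 + \<i> * of_real (tan (\<alpha> * pi / 2) * sgn k)))"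
      using 3 C unfolding imaginary_powr_neg[OF 3] tan stable_mu_def C_def[symmetric]
      by (simp add: complex_eq_iff C_def[symmetric])
    show ?thesis by (simp only: stable_exp_def h[unfolded minus_minus])
  qed
qed

text \<open>The shift y is chosen so that the power of the terminal price is K2 exp (u (y + x)); the
  trigger then reads x > - y. The cash leg is written with exp (0 (y + x)) to make both legs
  instances of one expectation.\<close>

lemma gap_power_call_payoff_eq:
  assumes "u > 0" "S > 0" "K2 > 0" and y: "y = log_moneyness u S K2 r \<tau> + \<mu> * \<tau>"
  shows "gap_power_call_payoff u K1 K2 (terminal_price S r \<mu> \<tau> x)
    = K2 * (indicator {- y<..} x * exp (u * (y + x))) - K1 * (indicator {- y<..} x * exp (0 * (y + x)))"
proof -
  have "u * ln (S / K2 powr (1 / u)) = u * ln S - ln K2"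
    using assms by (simp add: ln_div ln_powr right_diff_distrib)
  then have e: "u * (y + x) = u * ln S - ln K2 + u * ((r + \<mu>) * \<tau> + x)"
    by (simp add: y log_moneyness_def algebra_simps)
  have "terminal_price S r \<mu> \<tau> x powr u = exp (u * (ln S + ((r + \<mu>) * \<tau> + x)))"
    using assms by (simp add: terminal_price_def powr_def ln_mult)
  also have "\<dots> = exp (ln K2) * exp (u * (y + x))"
    unfolding e exp_add[symmetric] by (simp add: algebra_simps)
  finally have p: "terminal_price S r \<mu> \<tau> x powr u = K2 * exp (u * (y + x))" using assms by simp
  have "K2 * exp (u * (y + x)) - K2 > 0 \<longleftrightarrow> - y < x"
  proof -
    have "K2 * exp (u * (y + x)) - K2 > 0 \<longleftrightarrow> K2 * 1 < K2 * exp (u * (y + x))" by simp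
    also have "\<dots> \<longleftrightarrow> 0 < u * (y + x)" using assms by (simp only: mult_less_cancel_left_pos one_less_exp_iff)
    also have "\<dots> \<longleftrightarrow> - y < x" using assms by (auto simp: zero_less_mult_iff)
    finally show ?thesis .
  qed
  then show ?thesis by (simp add: gap_power_call_payoff_def p indicator_def left_diff_distrib)
qed

theorem mainTheorem8:
  fixes M :: "'a measure" and X :: "real \<Rightarrow> 'a \<Rightarrow> real"
    and \<alpha> \<sigma> u S K1 K2 r \<tau> \<mu> :: real
  assumes "1 < \<alpha>" and "\<alpha> \<le> 2" and "\<sigma> > 0" and "u > 0" and "S > 0"
    and "K1 > 0" and "K2 > 0" and "\<tau> > 0"
    and "spectrally_negative_stable_process M X \<alpha> \<sigma>"
    and "\<mu> = stable_mu \<alpha> \<sigma>"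
  shows "integrable M (\<lambda>\<omega>. gap_power_call_payoff u K1 K2 (terminal_price S r \<mu> \<tau> (X \<tau> \<omega>)))
    \<and> (\<forall>n. summable (\<lambda>m. AN_term \<alpha> u S K2 r \<mu> \<tau> n m))
    \<and> summable (\<lambda>n. \<Sum>m. AN_term \<alpha> u S K2 r \<mu> \<tau> n m)
    \<and> summable (\<lambda>n. CN_term \<alpha> u S K2 r \<mu> \<tau> n)
    \<and> option_value M X (gap_power_call_payoff u K1 K2) S r \<mu> \<tau>
        = C_AN \<alpha> u S K2 r \<mu> \<tau> - K1 * C_CN \<alpha> u S K2 r \<mu> \<tau>"
proof -
  interpret X: spectrally_negative_stable_process M X \<alpha> \<sigma> by fact
  note \<alpha> = assms(1,2)
  define c where "c = - \<mu> * \<tau>"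
  define y where "y = log_moneyness u S K2 r \<tau> + \<mu> * \<tau>"
  have "\<mu> < 0"
    using cos_half_pi_neg[OF \<alpha>] assms by (simp add: stable_mu_def divide_pos_neg)
  then have c: "0 < c" using assms by (simp add: c_def mult_neg_pos)
  have Xm [measurable]: "X \<tau> \<in> borel_measurable M" using assms by (intro X.rv) simp
  let ?D = "distr M borel (X \<tau>)"
  interpret D: real_distribution ?D
    by (rule X.real_distribution_distr) simp
  have char: "char ?D k = stable_exp \<alpha> c (Complex 0 k)" for k
    using X.char_stable[of \<tau> k] stable_char_eq[OF \<alpha>, of \<tau> \<sigma> k] assms by (simp add: c_def)
  have u: "0 \<le> u" using assms by simp
  let ?f = "\<lambda>u x. indicator {- y<..} x * exp (u * (y + x))"
  have [measurable]: "?f v \<in> borel_measurable borel" for v by measurable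
  have int: "integrable M (\<lambda>\<omega>. ?f v (X \<tau> \<omega>))" if "0 \<le> v" for v
    using D.expectation_exp_Ioi_stable(1)[OF \<alpha> c that less_add_one char, where y = y]
    by (subst (asm) integrable_distr_eq) auto
  have val: "(\<integral>x. ?f v x \<partial>?D) = (\<integral>\<omega>. ?f v (X \<tau> \<omega>) \<partial>M)" for v
    by (rule integral_distr) auto
  have AN: "AN_term \<alpha> u S K2 r \<mu> \<tau> n m = gap_coeff \<alpha> c u y n m" for n m
    by (simp add: AN_term_def gap_coeff_def c_def y_def)
  \<comment> \<open>The cash-or-nothing term is presented as a full row sum at u = 0, so that the
    series result for general u applies to it unchanged.\<close>
  have CN: "CN_term \<alpha> u S K2 r \<mu> \<tau> n = (\<Sum>m. gap_coeff \<alpha> c 0 y n m)" for n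
    unfolding gap_coeff_u_0 by (simp add: CN_term_def gap_coeff_def c_def y_def)
  note A = D.expectation_exp_Ioi_stable_series[OF \<alpha> c u char, of y, folded AN, unfolded val]
  note B = D.expectation_exp_Ioi_stable_series[OF \<alpha> c order_refl char, of y, folded CN, unfolded val]
  note payoff = gap_power_call_payoff_eq[OF assms(4,5,7) y_def]
  have "option_value M X (gap_power_call_payoff u K1 K2) S r \<mu> \<tau>
      = exp (- r * \<tau>) * (K2 * (\<integral>\<omega>. ?f u (X \<tau> \<omega>) \<partial>M) - K1 * (\<integral>\<omega>. ?f 0 (X \<tau> \<omega>) \<partial>M))"
    unfolding option_value_def payoff
    by (subst Bochner_Integration.integral_diff) (use int[OF u] int[of 0] in auto)
  also have "\<dots> = C_AN \<alpha> u S K2 r \<mu> \<tau> - K1 * C_CN \<alpha> u S K2 r \<mu> \<tau>"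
    unfolding C_AN_def C_CN_def sums_unique[OF A(2), symmetric] sums_unique[OF B(2), symmetric]
    using \<alpha> by (simp add: right_diff_distrib)
  finally have "option_value M X (gap_power_call_payoff u K1 K2) S r \<mu> \<tau> = \<dots>" .
  moreover have "integrable M (\<lambda>\<omega>. gap_power_call_payoff u K1 K2 (terminal_price S r \<mu> \<tau> (X \<tau> \<omega>)))"
    unfolding payoff by (intro Bochner_Integration.integrable_diff integrable_mult_right int u order_refl)
  ultimately show ?thesis
    using A(1) sums_summable[OF A(2)] sums_summable[OF B(2)] by blast
qed

end
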